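(* Let $p$ be an odd prime. Then there is no finite abelian group $G$ such that $|\mathrm{Aut}(G)|/|G| = p$.
   Context: $\mathrm{Aut}(G)$ denotes the group of automorphisms of the group $G$. *)

theory Defs
  imports "HOL-Algebra.Algebra" "HOL-Computational_Algebra.Primes"
begin

end

theory Submission
  imports Defs "HOL-Number_Theory.Totient"
begin

text \<open>
  Write $\phi$ for Euler's totient function, and split off a cyclic direct factor of maximal order:
  $G \cong C \times D$, where $C$ is cyclic of order $n$, the exponent of $G$. Since $D$ is killed
  by $n$, there are exactly $|D|$ homomorphisms $D \to C$ (\<open>card_homs_into_cyclic\<close>). The
  automorphisms of $C \times D$ that map $C$ to itself are the invertible triangular matrices with
  entries in $\mathrm{Aut}(C)$, $\mathrm{Hom}(D,C)$ and $\mathrm{Aut}(D)$, so Lagrange's theorem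
  makes $\phi(n)\,|\mathrm{Aut}(D)|\,|D|$ a divisor of $|\mathrm{Aut}(G)|$
  (\<open>totient_dvd_card_auto_prod\<close>). If $|\mathrm{Aut}(G)| = p\,|G| = p\,n\,|D|$ with $p$ an odd
  prime, then
    \[ \phi(n)\,|\mathrm{Aut}(D)| \;\mbox{divides}\; p\,n , \]
  and the rest is a parity argument. Applied to a 2-group $D$ in place of $G$, the same divisibility
  shows that $|D|$ divides $2\,|\mathrm{Aut}(D)|$ (\<open>two_group_order_dvd\<close>).
  
  If $|\mathrm{Aut}(D)|$ is odd, inversion must be trivial on $D$, so $D$ is an elementary abelian
  2-group, and then $|D| \le 2$. But with $|D| \le 2$ an automorphism of $C \times D$ is pinned down
  by the images of so few elements that $|\mathrm{Aut}(G)| < 3\,|G| \le p\,|G|$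
  (\<open>card_auto_prod_small\<close>).
  
  If $|\mathrm{Aut}(D)|$ is even, then $2\phi(n)$ divides $p\,n$. As $\phi(m)$ is even for $m > 2$,
  this forces $n$ to be a power of 2, and comparing powers of 2 once more gives
  $4 \nmid |\mathrm{Aut}(D)|$ and $|D| = 4$. So $G$ is a 2-group, and the triangular subgroup
  already has an order divisible by $|G|$; a contradiction needs only one further factor. When
  $n \ge 4$ it comes from the larger subgroup that preserves $C \times N$ for a subgroup $N$ of order
  2 in $D$ (\<open>card_auto_prod_order_four\<close>). When $n = 2$ the group is $(\mathbf{Z}/2)^3$, where
  elements of order 3 and 7 in the automorphism group show that $21$ divides $8p$.
\<close>

section \<open>Homomorphisms into a cyclic group\<close>

text \<open>
  Homomorphisms are taken to be extensional, so that there are finitely many of them and two are equal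
  as soon as they agree on the carrier. This is the same convention as for \<^const>\<open>auto\<close>.
\<close>

definition homs :: "('a, 'c) monoid_scheme \<Rightarrow> ('b, 'd) monoid_scheme \<Rightarrow> ('a \<Rightarrow> 'b) set"
  where "homs G H = hom G H \<inter> extensional (carrier G)"

lemma homsI: "f \<in> hom G H \<Longrightarrow> group G \<Longrightarrow> restrict f (carrier G) \<in> homs G H"
  by (auto simp: homs_def hom_def group.is_monoid monoid.m_closed Pi_iff)

lemma finite_homs:
  assumes "finite (carrier G)" "finite (carrier H)"
  shows "finite (homs G H)"
  by (rule finite_subset[OF _ finite_PiE[OF assms(1), of "\<lambda>_. carrier H"]])
     (auto simp: homs_def hom_def PiE_def assms)

lemma (in group) pow_eq_iff_dvd:
  assumes "x \<in> carrier G" "i \<le> (j::nat)"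
  shows "x [^] i = x [^] j \<longleftrightarrow> ord x dvd j - i"
proof -
  have "x [^] i = x [^] j \<longleftrightarrow> x [^] (j - i) = \<one>"
  proof -
    have "x [^] j = x [^] i \<otimes> x [^] (j - i)" using assms by (simp add: nat_pow_mult)
    thus ?thesis using assms l_cancel_one'[of "x [^] i" "x [^] (j - i)"] by auto
  qed
  thus ?thesis using pow_eq_id assms by simp
qed

text \<open>
  In a finite group inverses are positive powers, so closure under multiplication is enough. The
  exponent below is twice the order minus one rather than the order minus one, since the latter could
  be zero, and the neutral element is not known in advance to lie in the set.
\<close>

lemma (in group) finite_closed_imp_subgroup:
  assumes fin: "finite (carrier G)" and T: "T \<subseteq> carrier G" "T \<noteq> {}"
    and closed: "\<And>x y. x \<in> T \<Longrightarrow> y \<in> T \<Longrightarrow> x \<otimes> y \<in> T"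
  shows "subgroup T G"
proof (rule subgroupI)
  fix x assume x: "x \<in> T"
  then have xG: "x \<in> carrier G" using T by auto
  have pow: "x [^] Suc k \<in> T" for k :: nat
    by (induction k) (use x xG closed in auto)
  have "0 < ord x" using ord_ge_1[OF fin xG] by simp
  then obtain k where k: "ord x = Suc k" using gr0_implies_Suc by blast
  have "x [^] Suc (2 * k) \<otimes> x = x [^] (ord x * 2)"
    using k by (simp add: numeral_2_eq_2)
  also have "\<dots> = \<one>" using xG by (simp add: pow_eq_id)
  finally have "inv x = x [^] Suc (2 * k)" using xG by (meson inv_equality nat_pow_closed)
  thus "inv x \<in> T" using pow by metis
qed (use assms in auto)

locale finite_cyclic = group C for C (structure) +
  fixes g
  assumes finite_carrier: "finite (carrier C)"
    and gen_closed: "g \<in> carrier C"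
    and gen: "\<And>c. c \<in> carrier C \<Longrightarrow> \<exists>i::nat. c = g [^] i"
begin

lemma comm: "comm_group C"
proof (unfold_locales)
  fix x y assume "x \<in> carrier C" "y \<in> carrier C"
  then obtain i j :: nat where "x = g [^] i" "y = g [^] j" using gen by metis
  thus "x \<otimes> y = y \<otimes> x" using gen_closed by (simp add: nat_pow_mult add.commute)
qed

lemma order_eq: "order C = ord g"
proof -
  have "carrier C = generate C {g}"
    unfolding generate_pow_on_finite_carrier[OF finite_carrier gen_closed]
    using gen gen_closed by auto
  thus ?thesis using generate_pow_card[OF gen_closed] by (simp add: order_def)
qed

lemma order_pos: "order C > 0"
  using finite_carrier order_gt_0_iff_finite by simp

text \<open>
  In exponents with respect to the generator, the equation $c^m = b$ is a linear congruence modulo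
  $m n'$; the condition on $b$ is what makes it solvable, and the solutions then form one class modulo
  $n'$. This counts the possible values when a homomorphism is extended by one element.
\<close>

lemma card_roots:
  assumes n: "order C = m * n'" and b: "b \<in> carrier C" and b1: "b [^] n' = \<one>"
  shows "card {c \<in> carrier C. c [^] m = b} = m"
proof -
  have pos: "m > 0" "n' > 0" using n order_pos by auto
  have on: "ord g = m * n'" using n order_eq by simp
  obtain j where j: "b = g [^] (j::nat)" using gen b by metis
  have "m * n' dvd j * n'"
    using b1 gen_closed unfolding j on[symmetric]
    by (simp add: nat_pow_pow pow_eq_id)
  then obtain j' where j': "j = m * j'" using pos by (auto simp: dvd_def)
  have "{c \<in> carrier C. c [^] m = b} = (\<lambda>t. g [^] (j' + n' * t)) ` {..<m}"
  proof (intro equalityI subsetI)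
    fix c assume "c \<in> (\<lambda>t. g [^] (j' + n' * t)) ` {..<m}"
    then obtain t where t: "c = g [^] (j' + n' * t)" by auto
    have "c [^] m = g [^] (j + ord g * t)"
      using gen_closed by (simp add: t nat_pow_pow j' on algebra_simps)
    also have "\<dots> = b" using gen_closed
      by (simp add: j nat_pow_pow[symmetric] nat_pow_mult[symmetric])
    finally show "c \<in> {c \<in> carrier C. c [^] m = b}" using gen_closed t by simp
  next
    fix c assume c: "c \<in> {c \<in> carrier C. c [^] m = b}"
    then obtain i where i: "c = g [^] (i::nat)" using gen by auto
    define k where "k = i + ord g * j'"
    have k: "c = g [^] k" using gen_closed i
      by (simp add: k_def nat_pow_pow[symmetric] nat_pow_mult[symmetric])
    have kj: "j' \<le> k" using pos by (simp add: k_def on trans_le_add2)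
    have "g [^] (m * j') = g [^] (m * k)"
      using c k gen_closed j j' by (simp add: nat_pow_pow mult.commute)
    hence "m * n' dvd m * k - m * j'"
      using pow_eq_iff_dvd[OF gen_closed, of "m*j'" "m*k"] kj on by simp
    hence "n' dvd k - j'" using pos by (simp add: diff_mult_distrib2[symmetric])
    then obtain s where s: "k - j' = n' * s" by auto
    have "k = (j' + n' * (s mod m)) + ord g * (s div m)"
    proof -
      have "n' * s = n' * (s mod m + m * (s div m))" by simp
      also have "\<dots> = n' * (s mod m) + ord g * (s div m)"
        by (simp only: on distrib_left ac_simps)
      finally show ?thesis using s kj by linarith
    qed
    hence "c = g [^] (j' + n' * (s mod m))"
      using k gen_closed by (simp add: nat_pow_mult[symmetric] nat_pow_pow[symmetric])
    thus "c \<in> (\<lambda>t. g [^] (j' + n' * t)) ` {..<m}" using pos by auto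
  qed
  moreover have "inj_on (\<lambda>t. g [^] (j' + n' * t)) {..<m}"
  proof (rule linorder_inj_onI)
    fix s t assume st: "s < t" "s \<in> {..<m}" "t \<in> {..<m}"
    show "g [^] (j' + n' * s) \<noteq> g [^] (j' + n' * t)"
    proof
      assume "g [^] (j' + n' * s) = g [^] (j' + n' * t)"
      hence "m * n' dvd (j' + n' * t) - (j' + n' * s)"
        using pow_eq_iff_dvd[OF gen_closed, of "j' + n' * s" "j' + n' * t"] st on by simp
      hence "n' * m dvd n' * (t - s)" by (simp add: diff_mult_distrib2 mult.commute)
      hence "m dvd t - s" using pos by simp
      thus False using st by (auto dest: dvd_imp_le)
    qed
  qed auto
  ultimately show ?thesis by (simp add: card_image)
qed

end

text \<open>
  One step of extending a homomorphism $f$ from $H$ to a larger subgroup, namely the one generated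
  by $H$ and $x$. Here $m$ is the order of $x$ modulo $H$. An extension is determined by
  the image $c$ of $x$, and the only constraint on $c$ is $c^m = f(x^m)$.
\<close>

locale hom_step = G: comm_group G + C: comm_group C for G (structure) and C (structure) +
  fixes H x m f
  assumes H: "subgroup H G" and fin: "finite (carrier G)" and x: "x \<in> carrier G"
    and m: "m > (0::nat)" "x [^]\<^bsub>G\<^esub> m \<in> H"
    and minimal: "\<And>i. 0 < i \<Longrightarrow> i < m \<Longrightarrow> x [^]\<^bsub>G\<^esub> i \<notin> H"
    and f: "f \<in> hom (G\<lparr>carrier := H\<rparr>) C"
begin

definition K where "K = {h \<otimes>\<^bsub>G\<^esub> x [^]\<^bsub>G\<^esub> (i::nat) | h i. h \<in> H}"

lemma HG: "h \<in> H \<Longrightarrow> h \<in> carrier G" using H subgroup.subset by blast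

lemma H_pow: "h \<in> H \<Longrightarrow> h [^]\<^bsub>G\<^esub> (i::nat) \<in> H"
  by (induction i) (use H in \<open>auto intro: subgroup.m_closed subgroup.one_closed\<close>)

lemma f_closed: "h \<in> H \<Longrightarrow> f h \<in> carrier C" using f by (auto simp: hom_def)
lemma f_mult: "h \<in> H \<Longrightarrow> k \<in> H \<Longrightarrow> f (h \<otimes>\<^bsub>G\<^esub> k) = f h \<otimes>\<^bsub>C\<^esub> f k" using f by (auto simp: hom_def)
lemma f_one: "f \<one>\<^bsub>G\<^esub> = \<one>\<^bsub>C\<^esub>"
  using f_mult[of "\<one>\<^bsub>G\<^esub>" "\<one>\<^bsub>G\<^esub>"] f_closed[of "\<one>\<^bsub>G\<^esub>"] H
  by (simp add: subgroup.one_closed)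
lemma f_pow: "h \<in> H \<Longrightarrow> f (h [^]\<^bsub>G\<^esub> (i::nat)) = f h [^]\<^bsub>C\<^esub> i"
  by (induction i) (auto simp: f_one f_mult H_pow)

lemma pow_in_H_iff: "x [^]\<^bsub>G\<^esub> i \<in> H \<longleftrightarrow> m dvd i"
proof
  assume "m dvd i"
  then show "x [^]\<^bsub>G\<^esub> i \<in> H" using H_pow[OF m(2)] x by (auto simp: dvd_def G.nat_pow_pow)
next
  assume i: "x [^]\<^bsub>G\<^esub> i \<in> H"
  let ?a = "x [^]\<^bsub>G\<^esub> (m * (i div m))"
  have a: "?a \<in> H" using H_pow[OF m(2)] x by (simp add: G.nat_pow_pow)
  have "x [^]\<^bsub>G\<^esub> i = ?a \<otimes>\<^bsub>G\<^esub> x [^]\<^bsub>G\<^esub> (i mod m)" using x by (simp add: G.nat_pow_mult)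
  hence "x [^]\<^bsub>G\<^esub> (i mod m) = inv\<^bsub>G\<^esub> ?a \<otimes>\<^bsub>G\<^esub> x [^]\<^bsub>G\<^esub> i"
    using x by (simp add: G.inv_solve_left)
  also have "\<dots> \<in> H" using a i H by (simp add: subgroup.m_closed subgroup.m_inv_closed)
  finally have "x [^]\<^bsub>G\<^esub> (i mod m) \<in> H" .
  hence "i mod m = 0" using minimal[of "i mod m"] m(1) by fastforce
  thus "m dvd i" by auto
qed

lemma diff_dvd:
  assumes "h \<in> H" "h' \<in> H" "h \<otimes>\<^bsub>G\<^esub> x [^]\<^bsub>G\<^esub> i = h' \<otimes>\<^bsub>G\<^esub> x [^]\<^bsub>G\<^esub> j" "i \<le> j"
  shows "m dvd j - i" "h = h' \<otimes>\<^bsub>G\<^esub> x [^]\<^bsub>G\<^esub> (j - i)"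
proof -
  have "h \<otimes>\<^bsub>G\<^esub> x [^]\<^bsub>G\<^esub> i = (h' \<otimes>\<^bsub>G\<^esub> x [^]\<^bsub>G\<^esub> (j - i)) \<otimes>\<^bsub>G\<^esub> x [^]\<^bsub>G\<^esub> i"
    using assms HG x by (simp add: G.m_assoc G.nat_pow_mult)
  thus 1: "h = h' \<otimes>\<^bsub>G\<^esub> x [^]\<^bsub>G\<^esub> (j - i)"
    using assms HG x by (metis G.m_closed G.nat_pow_closed G.right_cancel)
  hence "x [^]\<^bsub>G\<^esub> (j - i) = inv\<^bsub>G\<^esub> h' \<otimes>\<^bsub>G\<^esub> h" using assms(1,2) HG x by (metis G.inv_solve_left G.nat_pow_closed)
  also have "\<dots> \<in> H" using assms H by (simp add: subgroup.m_closed subgroup.m_inv_closed)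
  finally show "m dvd j - i" using pow_in_H_iff by simp
qed

lemma K_subgroup: "subgroup K G"
proof (rule G.finite_closed_imp_subgroup[OF fin])
  show "K \<subseteq> carrier G" using HG x by (auto simp: K_def)
  show "K \<noteq> {}" using H by (auto simp: K_def intro: subgroup.one_closed)
  fix a b assume "a \<in> K" "b \<in> K"
  then obtain h i h' j where *: "a = h \<otimes>\<^bsub>G\<^esub> x [^]\<^bsub>G\<^esub> (i::nat)" "b = h' \<otimes>\<^bsub>G\<^esub> x [^]\<^bsub>G\<^esub> (j::nat)"
    "h \<in> H" "h' \<in> H" by (auto simp: K_def)
  have "a \<otimes>\<^bsub>G\<^esub> b = (h \<otimes>\<^bsub>G\<^esub> h') \<otimes>\<^bsub>G\<^esub> x [^]\<^bsub>G\<^esub> (i + j)"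
    using * HG x by (simp add: G.nat_pow_mult[symmetric] G.m_ac)
  thus "a \<otimes>\<^bsub>G\<^esub> b \<in> K" using * H by (auto simp: K_def intro: subgroup.m_closed)
qed

lemma H_le_K: "H \<subseteq> K"
proof
  fix h assume "h \<in> H"
  moreover from this have "h = h \<otimes>\<^bsub>G\<^esub> x [^]\<^bsub>G\<^esub> (0::nat)" using HG by simp
  ultimately show "h \<in> K" unfolding K_def by blast
qed

lemma x_in_K: "x \<in> K"
proof -
  have "x = \<one>\<^bsub>G\<^esub> \<otimes>\<^bsub>G\<^esub> x [^]\<^bsub>G\<^esub> (1::nat)" using x by simp
  thus ?thesis unfolding K_def using H subgroup.one_closed by blast
qed

lemma card_K: "card K = m * card H"
proof -
  have "bij_betw (\<lambda>(h, i). h \<otimes>\<^bsub>G\<^esub> x [^]\<^bsub>G\<^esub> i) (H \<times> {..<m}) K"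
  proof (rule bij_betwI')
    fix a b assume a: "a \<in> H \<times> {..<m}" and b: "b \<in> H \<times> {..<m}"
    obtain h i h' j where ab: "a = (h, i)" "b = (h', j)" by (cases a, cases b)
    have *: "h = h' \<and> i = j"
      if "h \<otimes>\<^bsub>G\<^esub> x [^]\<^bsub>G\<^esub> i = h' \<otimes>\<^bsub>G\<^esub> x [^]\<^bsub>G\<^esub> j" "i \<le> j" "h \<in> H" "h' \<in> H" "j < m"
      for h h' and i j :: nat
    proof -
      have d: "m dvd j - i" "h = h' \<otimes>\<^bsub>G\<^esub> x [^]\<^bsub>G\<^esub> (j - i)" using diff_dvd that by blast+
      have "i = j"
      proof (rule ccontr)
        assume "i \<noteq> j"
        hence "m \<le> j - i" using d(1) that(2) by (intro dvd_imp_le) auto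
        thus False using that(5) by linarith
      qed
      with d that HG show ?thesis by simp
    qed
    show "((case a of (h, i) \<Rightarrow> h \<otimes>\<^bsub>G\<^esub> x [^]\<^bsub>G\<^esub> i) = (case b of (h, i) \<Rightarrow> h \<otimes>\<^bsub>G\<^esub> x [^]\<^bsub>G\<^esub> i)) = (a = b)"
      using a b *[of h i h' j] *[of h' j h i] ab by (cases "i \<le> j") auto
  next
    fix y assume "y \<in> K"
    then obtain h i where y: "h \<in> H" "y = h \<otimes>\<^bsub>G\<^esub> x [^]\<^bsub>G\<^esub> (i::nat)" by (auto simp: K_def)
    have 1: "h \<otimes>\<^bsub>G\<^esub> x [^]\<^bsub>G\<^esub> (m * (i div m)) \<in> H"
      using y H pow_in_H_iff by (simp add: subgroup.m_closed)
    have "y = (h \<otimes>\<^bsub>G\<^esub> x [^]\<^bsub>G\<^esub> (m * (i div m))) \<otimes>\<^bsub>G\<^esub> x [^]\<^bsub>G\<^esub> (i mod m)"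
      using y x HG by (simp add: G.m_assoc G.nat_pow_mult)
    thus "\<exists>a\<in>H \<times> {..<m}. y = (case a of (h, i) \<Rightarrow> h \<otimes>\<^bsub>G\<^esub> x [^]\<^bsub>G\<^esub> i)"
      using 1 m(1) by (intro bexI[of _ "(h \<otimes>\<^bsub>G\<^esub> x [^]\<^bsub>G\<^esub> (m * (i div m)), i mod m)"]) auto
  qed (auto simp: K_def)
  hence "card (H \<times> {..<m}) = card K" by (rule bij_betw_same_card)
  thus ?thesis by (simp add: mult.commute card_cartesian_product)
qed

lemma extend:
  assumes c: "c \<in> carrier C" "c [^]\<^bsub>C\<^esub> m = f (x [^]\<^bsub>G\<^esub> m)"
  shows "\<exists>F \<in> hom (G\<lparr>carrier := K\<rparr>) C. (\<forall>h \<in> H. F h = f h) \<and> F x = c"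
proof -
  \<comment> \<open>The value is read off from any way of writing the argument as a product; \<open>eq\<close> shows that all of them agree.\<close>
  define F where "F y = (THE z. \<exists>h i. h \<in> H \<and> y = h \<otimes>\<^bsub>G\<^esub> x [^]\<^bsub>G\<^esub> (i::nat) \<and> z = f h \<otimes>\<^bsub>C\<^esub> c [^]\<^bsub>C\<^esub> i)" for y
  have eq: "f h \<otimes>\<^bsub>C\<^esub> c [^]\<^bsub>C\<^esub> i = f h' \<otimes>\<^bsub>C\<^esub> c [^]\<^bsub>C\<^esub> j"
    if hyp: "h \<in> H" "h' \<in> H" "h \<otimes>\<^bsub>G\<^esub> x [^]\<^bsub>G\<^esub> i = h' \<otimes>\<^bsub>G\<^esub> x [^]\<^bsub>G\<^esub> j" "i \<le> j" for h h' and i j :: nat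
  proof -
    obtain t where t: "j - i = m * t" using diff_dvd(1)[OF hyp] by auto
    have "f h = f (h' \<otimes>\<^bsub>G\<^esub> (x [^]\<^bsub>G\<^esub> m) [^]\<^bsub>G\<^esub> t)"
      using diff_dvd(2)[OF hyp] x t by (simp add: G.nat_pow_pow)
    also have "\<dots> = f h' \<otimes>\<^bsub>C\<^esub> (c [^]\<^bsub>C\<^esub> m) [^]\<^bsub>C\<^esub> t"
      using that m(2) c(2) by (simp add: f_mult H_pow f_pow)
    also have "\<dots> = f h' \<otimes>\<^bsub>C\<^esub> c [^]\<^bsub>C\<^esub> (j - i)" using c(1) t by (simp add: C.nat_pow_pow)
    finally show ?thesis using that c f_closed by (simp add: C.m_assoc C.nat_pow_mult)
  qed
  have F: "F (h \<otimes>\<^bsub>G\<^esub> x [^]\<^bsub>G\<^esub> i) = f h \<otimes>\<^bsub>C\<^esub> c [^]\<^bsub>C\<^esub> i" if h: "h \<in> H" for h and i :: nat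
    unfolding F_def
  proof (rule the_equality)
    fix z assume "\<exists>h' j. h' \<in> H \<and> h \<otimes>\<^bsub>G\<^esub> x [^]\<^bsub>G\<^esub> i = h' \<otimes>\<^bsub>G\<^esub> x [^]\<^bsub>G\<^esub> (j::nat) \<and> z = f h' \<otimes>\<^bsub>C\<^esub> c [^]\<^bsub>C\<^esub> j"
    then obtain h' j where *: "h' \<in> H" "h \<otimes>\<^bsub>G\<^esub> x [^]\<^bsub>G\<^esub> i = h' \<otimes>\<^bsub>G\<^esub> x [^]\<^bsub>G\<^esub> (j::nat)"
      "z = f h' \<otimes>\<^bsub>C\<^esub> c [^]\<^bsub>C\<^esub> j" by blast
    show "z = f h \<otimes>\<^bsub>C\<^esub> c [^]\<^bsub>C\<^esub> i"
      using eq[of h h' i j] eq[of h' h j i] * h by (cases "i \<le> j") auto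
  qed (use h in blast)
  have "F \<in> hom (G\<lparr>carrier := K\<rparr>) C"
  proof (rule homI)
    fix a assume "a \<in> carrier (G\<lparr>carrier := K\<rparr>)"
    then show "F a \<in> carrier C" using F f_closed c by (auto simp: K_def)
  next
    fix a b assume "a \<in> carrier (G\<lparr>carrier := K\<rparr>)" "b \<in> carrier (G\<lparr>carrier := K\<rparr>)"
    then obtain h i h' j where *: "a = h \<otimes>\<^bsub>G\<^esub> x [^]\<^bsub>G\<^esub> (i::nat)" "b = h' \<otimes>\<^bsub>G\<^esub> x [^]\<^bsub>G\<^esub> (j::nat)"
      "h \<in> H" "h' \<in> H" by (auto simp: K_def)
    have ab: "a \<otimes>\<^bsub>G\<^esub> b = (h \<otimes>\<^bsub>G\<^esub> h') \<otimes>\<^bsub>G\<^esub> x [^]\<^bsub>G\<^esub> (i + j)"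
      using * HG x by (simp add: G.nat_pow_mult[symmetric] G.m_ac)
    have "F (a \<otimes>\<^bsub>G\<^esub> b) = (f h \<otimes>\<^bsub>C\<^esub> f h') \<otimes>\<^bsub>C\<^esub> c [^]\<^bsub>C\<^esub> (i + j)"
      unfolding ab using * H by (simp add: F f_mult subgroup.m_closed)
    also have "\<dots> = F a \<otimes>\<^bsub>C\<^esub> F b"
      using * c f_closed by (simp add: F C.nat_pow_mult[symmetric] C.m_ac)
    finally show "F (a \<otimes>\<^bsub>G\<lparr>carrier := K\<rparr>\<^esub> b) = F a \<otimes>\<^bsub>C\<^esub> F b" by simp
  qed
  moreover have "F h = f h" if "h \<in> H" for h
    using F[OF that, of 0] that HG f_closed by simp
  moreover have "F x = c"
    using F[of "\<one>\<^bsub>G\<^esub>" 1] x c H f_one by (simp add: subgroup.one_closed)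
  ultimately show ?thesis by blast
qed

lemma card_extensions_step:
  "card {F \<in> homs (G\<lparr>carrier := K\<rparr>) C. \<forall>h\<in>H. F h = f h}
    = card {c \<in> carrier C. c [^]\<^bsub>C\<^esub> m = f (x [^]\<^bsub>G\<^esub> m)}"
proof (rule bij_betw_same_card[of "\<lambda>F. F x"], rule bij_betw_imageI)
  have K_group: "group (G\<lparr>carrier := K\<rparr>)" using K_subgroup G.subgroup_imp_group by blast
  have pow: "F (x [^]\<^bsub>G\<^esub> i) = F x [^]\<^bsub>C\<^esub> i" if "F \<in> hom (G\<lparr>carrier := K\<rparr>) C" for F and i :: nat
  proof -
    have "F (x [^]\<^bsub>G\<lparr>carrier := K\<rparr>\<^esub> i) = F x [^]\<^bsub>C\<^esub> i"
      using that x_in_K by (intro hom_nat_pow[OF that]) (auto simp: K_group C.is_group)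
    thus ?thesis by (simp add: G.nat_pow_consistent[symmetric])
  qed
  show "inj_on (\<lambda>F. F x) {F \<in> homs (G\<lparr>carrier := K\<rparr>) C. \<forall>h\<in>H. F h = f h}"
  proof (rule inj_onI)
    fix F F' assume F: "F \<in> {F \<in> homs (G\<lparr>carrier := K\<rparr>) C. \<forall>h\<in>H. F h = f h}"
      and F': "F' \<in> {F \<in> homs (G\<lparr>carrier := K\<rparr>) C. \<forall>h\<in>H. F h = f h}" and eq: "F x = F' x"
    show "F = F'"
    proof (rule extensionalityI)
      fix y assume y: "y \<in> K"
      then obtain h i where hi: "h \<in> H" "y = h \<otimes>\<^bsub>G\<^esub> x [^]\<^bsub>G\<^esub> (i::nat)" by (auto simp: K_def)
      have xi: "x [^]\<^bsub>G\<^esub> i \<in> K"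
        using monoid.nat_pow_closed[OF group.is_monoid[OF K_group], of x i] x_in_K
        by (simp add: G.nat_pow_consistent[symmetric])
      have hom: "F \<in> hom (G\<lparr>carrier := K\<rparr>) C" "F' \<in> hom (G\<lparr>carrier := K\<rparr>) C"
        using F F' by (simp_all add: homs_def)
      have hK: "h \<in> K" using hi(1) H_le_K by blast
      have "F y = F h \<otimes>\<^bsub>C\<^esub> F (x [^]\<^bsub>G\<^esub> i)"
        using hom_mult[OF hom(1), of h "x [^]\<^bsub>G\<^esub> i"] hK xi hi(2) by simp
      moreover have "F' y = F' h \<otimes>\<^bsub>C\<^esub> F' (x [^]\<^bsub>G\<^esub> i)"
        using hom_mult[OF hom(2), of h "x [^]\<^bsub>G\<^esub> i"] hK xi hi(2) by simp
      moreover have "F h = F' h" using F F' hi(1) by simp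
      ultimately show "F y = F' y" using eq by (simp add: pow[OF hom(1)] pow[OF hom(2)])
    qed (use F F' in \<open>auto simp: homs_def\<close>)
  qed
  show "(\<lambda>F. F x) ` {F \<in> homs (G\<lparr>carrier := K\<rparr>) C. \<forall>h\<in>H. F h = f h}
        = {c \<in> carrier C. c [^]\<^bsub>C\<^esub> m = f (x [^]\<^bsub>G\<^esub> m)}" (is "?L = ?R")
  proof (intro equalityI subsetI)
    fix c assume "c \<in> ?L"
    then obtain F where F: "F \<in> hom (G\<lparr>carrier := K\<rparr>) C" "\<forall>h\<in>H. F h = f h" "c = F x"
      by (auto simp: homs_def)
    thus "c \<in> ?R" using m(2) x_in_K hom_in_carrier[OF F(1), of x] by (simp add: pow[OF F(1), symmetric])
  next
    fix c assume "c \<in> ?R"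
    then obtain F where F: "F \<in> hom (G\<lparr>carrier := K\<rparr>) C" "\<forall>h \<in> H. F h = f h" "F x = c"
      using extend by blast
    have "restrict F K \<in> homs (G\<lparr>carrier := K\<rparr>) C" using homsI[OF F(1) K_group] by simp
    moreover have "\<forall>h\<in>H. restrict F K h = f h" "restrict F K x = c"
      using F H_le_K x_in_K by auto
    ultimately show "c \<in> ?L" by blast
  qed
qed

end

text \<open>
  The number of extensions is the index of $H$, independently of $f$. For a step of index $m$ the
  extensions correspond to the solutions of $c^m = f(x^m)$ in $C$; as the exponent of $G$ divides the
  order of $C$, \<open>card_roots\<close> applies and gives exactly $m$ of them. Two consequences are used:
  some extension exists, which splits off cyclic factors, and for trivial $H$ the theorem counts all
  homomorphisms.
\<close>

theorem card_hom_extensions: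
  assumes "comm_group G" "finite (carrier G)" "finite_cyclic C g"
    and expo: "\<And>y. y \<in> carrier G \<Longrightarrow> y [^]\<^bsub>G\<^esub> order C = \<one>\<^bsub>G\<^esub>"
    and "subgroup H G" "f \<in> hom (G\<lparr>carrier := H\<rparr>) C"
  shows "card {F \<in> homs G C. \<forall>h\<in>H. F h = f h} * card H = card (carrier G)"
  using assms(5,6)
proof (induction "card (carrier G) - card H" arbitrary: H f rule: less_induct)
  case less
  interpret G: comm_group G by fact
  interpret Cy: finite_cyclic C g by fact
  interpret C: comm_group C by (rule Cy.comm)
  have HG: "H \<subseteq> carrier G" using less.prems subgroup.subset by blast
  show ?case
  proof (cases "H = carrier G")
    case True
    have "{F \<in> homs G C. \<forall>h\<in>H. F h = f h} = {restrict f (carrier G)}"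
      using less.prems True homsI[of f G C]
      by (auto simp: homs_def extensional_def fun_eq_iff)
    thus ?thesis using True by simp
  next
    case False
    then obtain x where x: "x \<in> carrier G" "x \<notin> H" using HG by blast
    define m where "m = (LEAST i. 0 < i \<and> x [^]\<^bsub>G\<^esub> (i::nat) \<in> H)"
    have "0 < order C \<and> x [^]\<^bsub>G\<^esub> order C \<in> H"
      using expo x less.prems Cy.order_pos by (simp add: subgroup.one_closed)
    hence m: "0 < m \<and> x [^]\<^bsub>G\<^esub> m \<in> H" unfolding m_def by (rule LeastI)
    have min: "x [^]\<^bsub>G\<^esub> i \<notin> H" if "0 < i" "i < m" for i
      using that not_less_Least[of i] unfolding m_def by blast
    interpret S: hom_step G C H x m f
      using less.prems assms(1,2) x m min C.comm_group_axioms
      by (intro hom_step.intro hom_step_axioms.intro) auto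
    have fin: "finite (carrier C)" by (rule Cy.finite_carrier)
    let ?A = "{F \<in> homs (G\<lparr>carrier := S.K\<rparr>) C. \<forall>h\<in>H. F h = f h}"
    let ?E = "\<lambda>f'. {F \<in> homs G C. \<forall>h\<in>S.K. F h = f' h}"
    have K: "S.K \<subseteq> carrier G" using S.K_subgroup subgroup.subset by blast
    have finK: "finite S.K" using K assms(2) finite_subset by blast
    have finA: "finite ?A" using finite_homs[of "G\<lparr>carrier := S.K\<rparr>" C] finK fin by simp
    have "m dvd order C" using S.pow_in_H_iff[of "order C"] expo x less.prems
      by (simp add: subgroup.one_closed)
    then obtain n' where n': "order C = m * n'" by auto
    have "f (x [^]\<^bsub>G\<^esub> m) [^]\<^bsub>C\<^esub> n' = f (x [^]\<^bsub>G\<^esub> order C)"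
      using x m n' by (simp add: S.f_pow[symmetric] G.nat_pow_pow)
    hence cardA: "card ?A = m"
      unfolding S.card_extensions_step using expo[OF x(1)] m S.f_closed
      by (intro Cy.card_roots[OF n']) (auto simp: S.f_one)
    have "H \<subset> S.K" using S.H_le_K S.x_in_K x by auto
    hence "card H < card S.K" using finK psubset_card_mono by blast
    moreover have "card S.K \<le> card (carrier G)" using K assms(2) card_mono by blast
    ultimately have "card (carrier G) - card S.K < card (carrier G) - card H" by linarith
    hence IH: "card (?E f') * card S.K = card (carrier G)" if "f' \<in> ?A" for f'
      using that less.hyps S.K_subgroup by (auto simp: homs_def)
    have un: "{F \<in> homs G C. \<forall>h\<in>H. F h = f h} = (\<Union>f'\<in>?A. ?E f')"
    proof (intro equalityI subsetI)
      fix F assume F: "F \<in> {F \<in> homs G C. \<forall>h\<in>H. F h = f h}"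
      have "restrict F S.K \<in> ?A"
        using F K S.H_le_K subgroup.m_closed[OF S.K_subgroup]
        by (auto simp: homs_def hom_def Pi_iff subset_iff)
      moreover have "F \<in> ?E (restrict F S.K)" using F by auto
      ultimately show "F \<in> (\<Union>f'\<in>?A. ?E f')" by blast
    qed (use S.H_le_K in auto)
    have "card (\<Union>f'\<in>?A. ?E f') = (\<Sum>f'\<in>?A. card (?E f'))"
    proof (rule card_UN_disjoint[OF finA])
      show "\<forall>f'\<in>?A. finite (?E f')" using finite_homs[OF assms(2) fin] by auto
      show "\<forall>a\<in>?A. \<forall>b\<in>?A. a \<noteq> b \<longrightarrow> ?E a \<inter> ?E b = {}"
      proof (intro ballI impI)
        fix a b assume ab: "a \<in> ?A" "b \<in> ?A" "a \<noteq> b"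
        show "?E a \<inter> ?E b = {}"
        proof (rule ccontr)
          assume "?E a \<inter> ?E b \<noteq> {}"
          then obtain F where "\<forall>h\<in>S.K. F h = a h" "\<forall>h\<in>S.K. F h = b h" by auto
          hence "a = b" using ab by (intro extensionalityI[of a S.K b]) (auto simp: homs_def)
          thus False using ab by simp
        qed
      qed
    qed
    hence "card {F \<in> homs G C. \<forall>h\<in>H. F h = f h} * card S.K = (\<Sum>f'\<in>?A. card (?E f') * card S.K)"
      by (simp add: un sum_distrib_right)
    also have "\<dots> = m * card (carrier G)" using IH cardA by simp
    finally show ?thesis using S.card_K m by (simp add: mult.left_commute)
  qed
qed

corollary card_homs_into_cyclic:
  assumes "comm_group G" "finite (carrier G)" "finite_cyclic C g"
    and "\<And>y. y \<in> carrier G \<Longrightarrow> y [^]\<^bsub>G\<^esub> order C = \<one>\<^bsub>G\<^esub>"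
  shows "card (homs G C) = card (carrier G)"
proof -
  interpret G: comm_group G by fact
  interpret Cy: finite_cyclic C g by fact
  have one: "F \<one>\<^bsub>G\<^esub> = \<one>\<^bsub>C\<^esub>" if "F \<in> homs G C" for F
    using that hom_one[of F G C] by (simp add: homs_def G.is_group Cy.is_group)
  have "(\<lambda>_. \<one>\<^bsub>C\<^esub>) \<in> hom (G\<lparr>carrier := {\<one>\<^bsub>G\<^esub>}\<rparr>) C" by (auto simp: hom_def)
  from card_hom_extensions[OF assms G.triv_subgroup this]
  have "card {F \<in> homs G C. F \<one>\<^bsub>G\<^esub> = \<one>\<^bsub>C\<^esub>} = card (carrier G)" by simp
  moreover have "{F \<in> homs G C. F \<one>\<^bsub>G\<^esub> = \<one>\<^bsub>C\<^esub>} = homs G C" using one by auto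
  ultimately show ?thesis by simp
qed

section \<open>Splitting off a cyclic factor of maximal order\<close>

text \<open>
  Take $x$ of maximal order. If the order of $y$ did not divide it, some prime $q$ would occur in the
  order of $y$ with a larger exponent. Replacing the $q$-part of $x$ by the $q$-part of $y$ would then
  give an element of larger order.
\<close>

lemma (in comm_group) exists_exponent_element:
  assumes fin: "finite (carrier G)"
  shows "\<exists>x \<in> carrier G. \<forall>y \<in> carrier G. ord y dvd ord x"
proof -
  have "finite (ord ` carrier G)" "ord ` carrier G \<noteq> {}" using fin by auto
  hence "Max (ord ` carrier G) \<in> ord ` carrier G" by (rule Max_in)
  then obtain x where x: "x \<in> carrier G" and max: "ord x = Max (ord ` carrier G)" by auto
  have le: "ord z \<le> ord x" if "z \<in> carrier G" for z
    unfolding max using fin that by (intro Max_ge) auto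
  have "ord y dvd ord x" if y: "y \<in> carrier G" for y
  proof (rule ccontr)
    assume "\<not> ord y dvd ord x"
    moreover have ox: "ord x \<noteq> 0" and oy: "ord y \<noteq> 0"
      using ord_ge_1[OF fin] x y by fastforce+
    ultimately obtain q where q: "Factorial_Ring.prime q"
      and lt: "multiplicity q (ord x) < multiplicity q (ord y)"
      by (metis multiplicity_le_imp_dvd not_le)
    define s where "s = multiplicity q (ord x)"
    define a where "a = multiplicity q (ord y)"
    obtain n' where n': "ord x = q ^ s * n'"
      using multiplicity_dvd[of q "ord x"] unfolding s_def by (auto simp: dvd_def)
    have q0: "q > 0" using q prime_gt_0_nat by blast
    have "\<not> q dvd n'"
    proof
      assume "q dvd n'"
      hence "q ^ Suc s dvd ord x" using n' by (simp add: mult.commute)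
      thus False using ox q power_dvd_iff_le_multiplicity[of "ord x" q "Suc s"]
        prime_gt_1_nat[OF q] by (simp add: s_def)
    qed
    hence cop: "coprime n' (q ^ a)"
      using q by (metis coprime_commute coprime_power_right_iff prime_imp_coprime)
    obtain m where m: "ord y = q ^ a * m"
      using multiplicity_dvd[of q "ord y"] unfolding a_def by (auto simp: dvd_def)
    define x' where "x' = x [^] (q ^ s)"
    define y' where "y' = y [^] m"
    have xy': "x' \<in> carrier G" "y' \<in> carrier G" using x y by (auto simp: x'_def y'_def)
    have ord_x': "ord x' = n'" unfolding x'_def using ord_pow[OF x, of "q ^ s"] n' q0 by simp
    have ord_y': "ord y' = q ^ a" unfolding y'_def using ord_pow[OF y, of m] m oy by simp
    define z where "z = x' \<otimes> y'"
    have z: "z \<in> carrier G" using xy' by (simp add: z_def)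
    have zpow: "z [^] (ord z * j) = \<one>" for j using z by (simp add: nat_pow_pow[symmetric])
    have "x' [^] (ord z * q ^ a) = z [^] (ord z * q ^ a)"
      using xy' by (simp add: z_def pow_mult_distrib m_comm pow_eq_id ord_y')
    hence "n' dvd ord z * q ^ a" using xy' zpow by (metis pow_eq_id ord_x')
    hence 1: "n' dvd ord z" using cop by (simp add: coprime_dvd_mult_left_iff)
    have "y' [^] (ord z * n') = z [^] (ord z * n')"
      using xy' by (simp add: z_def pow_mult_distrib m_comm pow_eq_id ord_x')
    hence "q ^ a dvd ord z * n'" using xy' zpow by (metis pow_eq_id ord_y')
    hence 2: "q ^ a dvd ord z" using cop by (simp add: coprime_dvd_mult_left_iff coprime_commute)
    have "n' * q ^ a dvd ord z" using 1 2 cop by (rule divides_mult)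
    hence "n' * q ^ a \<le> ord x" using le[OF z] ord_ge_1[OF fin z] by (meson dvd_imp_le less_le_trans not_less zero_less_one order_trans)
    moreover have "ord x < n' * q ^ a"
    proof -
      have "s < a" using lt by (simp only: s_def a_def)
      hence "q ^ s < q ^ a" using prime_gt_1_nat[OF q] by (rule power_strict_increasing)
      thus ?thesis using n' ox by (simp add: mult.commute)
    qed
    ultimately show False by simp
  qed
  thus ?thesis using x by blast
qed

text \<open>
  The identity of the cyclic subgroup $C$ generated by an element of maximal order extends to a
  homomorphism $F$ from the whole group to $C$. Such a retraction splits the group into $C$ and the
  kernel of $F$.
\<close>

theorem cyclic_direct_factor:
  fixes G :: "('a, 'b) monoid_scheme"
  assumes "comm_group G" and fin: "finite (carrier G)"
  obtains C D :: "('a, 'b) monoid_scheme" and g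
  where "finite_cyclic C g" "comm_group D" "finite (carrier D)"
    "\<And>d. d \<in> carrier D \<Longrightarrow> d [^]\<^bsub>D\<^esub> order C = \<one>\<^bsub>D\<^esub>" "C \<times>\<times> D \<cong> G"
proof -
  interpret G: comm_group G by fact
  obtain x where x: "x \<in> carrier G" and expo: "\<And>y. y \<in> carrier G \<Longrightarrow> G.ord y dvd G.ord x"
    using G.exists_exponent_element[OF fin] by blast
  define A where "A = generate G {x}"
  define C where "C = G\<lparr>carrier := A\<rparr>"
  have A: "subgroup A G" unfolding A_def using x by (intro G.generate_is_subgroup) auto
  have AG: "A \<subseteq> carrier G" using A subgroup.subset by blast
  have A_eq: "A = {x [^]\<^bsub>G\<^esub> k | k. k \<in> (UNIV :: nat set)}"
    unfolding A_def by (rule G.generate_pow_on_finite_carrier[OF fin x])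
  have xA: "x \<in> A" unfolding A_def by (simp add: generate.incl)
  interpret Cg: group C unfolding C_def using A G.subgroup_imp_group by blast
  have Cy: "finite_cyclic C x"
    by unfold_locales
       (use xA A_eq AG finite_subset[OF AG fin] in \<open>auto simp: C_def G.nat_pow_consistent[symmetric]\<close>)
  then interpret Cy: finite_cyclic C x .
  have ordC: "order C = G.ord x"
    using G.generate_pow_card[OF x] by (simp add: order_def C_def A_def)
  have exp1: "y [^]\<^bsub>G\<^esub> order C = \<one>\<^bsub>G\<^esub>" if "y \<in> carrier G" for y
    using that expo by (simp add: ordC G.pow_eq_id)
  have "(\<lambda>a. a) \<in> hom (G\<lparr>carrier := A\<rparr>) C" by (auto simp: C_def hom_def)
  from card_hom_extensions[OF assms Cy exp1 A this]
  have "card {F \<in> homs G C. \<forall>h\<in>A. F h = h} \<noteq> 0"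
    using fin G.one_closed by (metis card_eq_0_iff empty_iff mult_0)
  then obtain F where F: "F \<in> hom G C" and FA: "\<And>h. h \<in> A \<Longrightarrow> F h = h"
    by (auto simp: homs_def card_eq_0_iff)
  interpret F: group_hom G C F by unfold_locales (rule F)
  define B where "B = kernel G C F"
  define D where "D = G\<lparr>carrier := B\<rparr>"
  have B: "subgroup B G" unfolding B_def by (rule F.subgroup_kernel)
  have BG: "B \<subseteq> carrier G" using B subgroup.subset by blast
  have D: "comm_group D" unfolding D_def using B
    by (intro group.group_comm_groupI G.subgroup_imp_group) (auto dest: subgroup.mem_carrier intro: G.m_comm)
  interpret D: comm_group D by fact
  have Fcl: "F y \<in> A" if "y \<in> carrier G" for y using F.hom_closed[OF that] by (simp add: C_def)
  have FB: "F b = \<one>\<^bsub>G\<^esub>" if "b \<in> B" for b using that by (simp add: B_def kernel_def C_def)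
  have Fm: "F (a \<otimes>\<^bsub>G\<^esub> b) = F a \<otimes>\<^bsub>G\<^esub> F b" if "a \<in> carrier G" "b \<in> carrier G" for a b
    using F.hom_mult[OF that] by (simp add: C_def)
  have Fi: "F (inv\<^bsub>G\<^esub> y) = inv\<^bsub>G\<^esub> (F y)" if "y \<in> carrier G" for y
    using that Fm[of "inv\<^bsub>G\<^esub> y" y] Fcl AG FB[of "\<one>\<^bsub>G\<^esub>"] B
    by (metis G.inv_closed G.inv_equality G.l_inv subgroup.one_closed subsetD)
  have "(\<lambda>(a, b). a \<otimes>\<^bsub>G\<^esub> b) \<in> iso (C \<times>\<times> D) G"
  proof (rule isoI)
    show "(\<lambda>(a, b). a \<otimes>\<^bsub>G\<^esub> b) \<in> hom (C \<times>\<times> D) G"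
      using AG BG by (auto simp: hom_def C_def D_def subset_iff G.m_ac)
    show "bij_betw (\<lambda>(a, b). a \<otimes>\<^bsub>G\<^esub> b) (carrier (C \<times>\<times> D)) (carrier G)"
    proof (rule bij_betwI')
      fix u v assume "u \<in> carrier (C \<times>\<times> D)" "v \<in> carrier (C \<times>\<times> D)"
      then obtain a b a' b' where *: "u = (a, b)" "v = (a', b')" "a \<in> A" "a' \<in> A" "b \<in> B" "b' \<in> B"
        by (auto simp: C_def D_def)
      have G: "a \<in> carrier G" "a' \<in> carrier G" "b \<in> carrier G" "b' \<in> carrier G" using * AG BG by auto
      have "a = a' \<and> b = b'" if "a \<otimes>\<^bsub>G\<^esub> b = a' \<otimes>\<^bsub>G\<^esub> b'"
      proof -
        have "F (a \<otimes>\<^bsub>G\<^esub> b) = F (a' \<otimes>\<^bsub>G\<^esub> b')" using that by simp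
        hence "a = a'" using * G by (simp add: C_def FA FB)
        thus ?thesis using that G by simp
      qed
      thus "((case u of (a, b) \<Rightarrow> a \<otimes>\<^bsub>G\<^esub> b) = (case v of (a, b) \<Rightarrow> a \<otimes>\<^bsub>G\<^esub> b)) = (u = v)"
        using * by auto
    next
      fix u assume "u \<in> carrier (C \<times>\<times> D)"
      thus "(case u of (a, b) \<Rightarrow> a \<otimes>\<^bsub>G\<^esub> b) \<in> carrier G" using AG BG by (auto simp: C_def D_def)
    next
      fix y assume y: "y \<in> carrier G"
      have Fy: "F y \<in> A" "F y \<in> carrier G" using Fcl[OF y] AG by auto
      have "F (inv\<^bsub>G\<^esub> (F y) \<otimes>\<^bsub>G\<^esub> y) = \<one>\<^bsub>G\<^esub>" using y Fy by (simp only: Fm Fi FA G.inv_closed G.l_inv)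
      hence "inv\<^bsub>G\<^esub> (F y) \<otimes>\<^bsub>G\<^esub> y \<in> B" using y Fy by (simp add: B_def kernel_def C_def)
      moreover have "y = F y \<otimes>\<^bsub>G\<^esub> (inv\<^bsub>G\<^esub> (F y) \<otimes>\<^bsub>G\<^esub> y)" using y Fy by (simp add: G.m_assoc[symmetric])
      ultimately show "\<exists>u\<in>carrier (C \<times>\<times> D). y = (case u of (a, b) \<Rightarrow> a \<otimes>\<^bsub>G\<^esub> b)"
        using Fy by (intro bexI[of _ "(F y, inv\<^bsub>G\<^esub> (F y) \<otimes>\<^bsub>G\<^esub> y)"]) (auto simp: C_def D_def)
    qed
  qed
  hence "C \<times>\<times> D \<cong> G" by (rule is_isoI)
  moreover have "finite (carrier D)" using finite_subset[OF BG fin] by (simp add: D_def)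
  moreover have "d [^]\<^bsub>D\<^esub> order C = \<one>\<^bsub>D\<^esub>" if "d \<in> carrier D" for d
    using that BG exp1 by (auto simp: D_def G.nat_pow_consistent[symmetric])
  ultimately show thesis using that Cy D by blast
qed

section \<open>Counting automorphisms\<close>

lemma autoI:
  assumes "f \<in> hom G G" "inj_on f (carrier G)" "f \<in> extensional (carrier G)" "finite (carrier G)"
  shows "f \<in> auto G"
  using assms endo_inj_surj[of "carrier G" f]
  by (auto simp: auto_def Bij_def bij_betw_def hom_def)

lemma autoD:
  assumes "f \<in> auto G"
  shows "f \<in> hom G G" "inj_on f (carrier G)" "f ` carrier G = carrier G" "f \<in> extensional (carrier G)"
  using assms by (auto simp: auto_def Bij_def bij_betw_def)

lemma finite_auto: "finite (carrier G) \<Longrightarrow> finite (auto G)"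
  by (rule finite_subset[OF _ finite_homs[of G G]]) (auto simp: homs_def auto_def Bij_def)

lemma order_AutoGroup: "order (AutoGroup G) = card (auto G)"
  by (simp add: order_def AutoGroup_def)

lemma card_auto_cong:
  assumes "G \<cong> H" "group G" "group H"
  shows "card (auto G) = card (auto H)"
proof -
  \<comment> \<open>Conjugation by an isomorphism embeds one automorphism group into the other; by symmetry this suffices.\<close>
  have "\<exists>f. inj_on f (auto G) \<and> f ` auto G \<subseteq> auto H" if "\<phi> \<in> iso G H" "group G" "group H"
    for G :: "('x, 'y) monoid_scheme" and H :: "('z, 'w) monoid_scheme" and \<phi>
  proof -
    interpret G: group G by fact
    interpret H: group H by fact
    define \<psi> where "\<psi> = inv_into (carrier G) \<phi>"
    have \<phi>: "\<phi> \<in> hom G H" "bij_betw \<phi> (carrier G) (carrier H)" using that by (auto simp: iso_def)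
    have \<psi>: "\<psi> \<in> hom H G" "bij_betw \<psi> (carrier H) (carrier G)"
      using G.iso_set_sym[OF that(1)] by (auto simp: iso_def \<psi>_def)
    have \<psi>\<phi>: "\<psi> (\<phi> x) = x" if "x \<in> carrier G" for x
      using that \<phi>(2) by (simp add: \<psi>_def bij_betw_inv_into_left)
    define f where "f \<sigma> = restrict (\<phi> \<circ> \<sigma> \<circ> \<psi>) (carrier H)" for \<sigma>
    have "f \<sigma> \<in> auto H" if s: "\<sigma> \<in> auto G" for \<sigma>
    proof -
      have "\<phi> \<circ> \<sigma> \<circ> \<psi> \<in> hom H H"
        by (rule hom_compose[OF \<psi>(1) hom_compose[OF autoD(1)[OF s] \<phi>(1)]])
      moreover have "bij_betw \<sigma> (carrier G) (carrier G)"
        using autoD[OF s] by (simp add: bij_betw_def)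
      from bij_betw_trans[OF \<psi>(2) bij_betw_trans[OF this \<phi>(2)]]
      have "bij_betw (\<phi> \<circ> \<sigma> \<circ> \<psi>) (carrier H) (carrier H)" .
      ultimately show ?thesis
        using homsI[of "\<phi> \<circ> \<sigma> \<circ> \<psi>" H H] that
        by (auto simp: f_def auto_def Bij_def homs_def H.is_group cong: bij_betw_cong)
    qed
    moreover have "inj_on f (auto G)"
    proof (rule inj_onI)
      fix \<sigma> \<tau> assume s: "\<sigma> \<in> auto G" "\<tau> \<in> auto G" "f \<sigma> = f \<tau>"
      show "\<sigma> = \<tau>"
      proof (rule extensionalityI[OF autoD(4)[OF s(1)] autoD(4)[OF s(2)]])
        fix x assume x: "x \<in> carrier G"
        have "f \<sigma> (\<phi> x) = f \<tau> (\<phi> x)" using s by simp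
        hence "\<phi> (\<sigma> x) = \<phi> (\<tau> x)" using x \<phi> by (simp add: f_def \<psi>\<phi> hom_in_carrier)
        moreover have "\<sigma> x \<in> carrier G" "\<tau> x \<in> carrier G"
          using x autoD(3) s by blast+
        ultimately show "\<sigma> x = \<tau> x" using \<phi>(2) by (auto simp: bij_betw_def inj_on_def)
      qed
    qed
    ultimately show ?thesis by blast
  qed
  note main = this
  obtain \<phi> where \<phi>: "\<phi> \<in> iso G H" using assms by (auto simp: is_iso_def)
  obtain \<psi> where \<psi>: "\<psi> \<in> iso H G"
    using group.iso_set_sym[OF assms(2) \<phi>] by blast
  show ?thesis
  proof (cases "finite (auto G) \<or> finite (auto H)")
    case True
    hence "finite (auto G)" "finite (auto H)"
      using main[OF \<phi>] main[OF \<psi>] assms by (meson finite_imageD finite_subset)+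
    thus ?thesis using main[OF \<phi>] main[OF \<psi>] assms by (meson card_inj_on_le le_antisym)
  qed auto
qed

lemma card_dvd_card_auto:
  assumes "group G" "finite (carrier G)" "T \<subseteq> auto G" "T \<noteq> {}"
    and "\<And>f h. f \<in> T \<Longrightarrow> h \<in> T \<Longrightarrow> compose (carrier G) f h \<in> T"
  shows "card T dvd card (auto G)"
proof -
  interpret A: group "AutoGroup G" by (rule group.AutoGroup[OF assms(1)])
  have car: "carrier (AutoGroup G) = auto G" by (simp add: AutoGroup_def)
  have "subgroup T (AutoGroup G)"
  proof (rule A.finite_closed_imp_subgroup)
    fix f h assume fh: "f \<in> T" "h \<in> T"
    hence "f \<in> Bij (carrier G)" "h \<in> Bij (carrier G)" using assms(3) by (auto simp: auto_def)
    thus "f \<otimes>\<^bsub>AutoGroup G\<^esub> h \<in> T" using assms(5)[OF fh] by (simp add: AutoGroup_def BijGroup_def)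
  qed (use assms finite_auto car in auto)
  from A.lagrange[OF this] show ?thesis by (metis dvd_triv_right order_AutoGroup)
qed

lemma prime_dvd_card_auto:
  assumes "group G" "finite (carrier G)" "Factorial_Ring.prime (q::nat)" "f \<in> auto G"
    and iter: "\<And>x. x \<in> carrier G \<Longrightarrow> (f ^^ q) x = x"
    and nontriv: "\<exists>x \<in> carrier G. f x \<noteq> x"
  shows "q dvd card (auto G)"
proof -
  interpret A: group "AutoGroup G" by (rule group.AutoGroup[OF assms(1)])
  have car: "carrier (AutoGroup G) = auto G" by (simp add: AutoGroup_def)
  have Bij: "h \<in> auto G \<Longrightarrow> h \<in> Bij (carrier G)" for h by (auto simp: auto_def)
  have one: "\<one>\<^bsub>AutoGroup G\<^esub> = (\<lambda>x\<in>carrier G. x)" by (simp add: AutoGroup_def BijGroup_def)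
  have fG: "f x \<in> carrier G" if "x \<in> carrier G" for x using that assms(4) autoD(3) by blast
  have pow: "f [^]\<^bsub>AutoGroup G\<^esub> k = restrict (f ^^ k) (carrier G)" for k :: nat
  proof (induction k)
    case 0 show ?case by (auto simp: one)
  next
    case (Suc k)
    have "f [^]\<^bsub>AutoGroup G\<^esub> k \<in> auto G" using assms(4) A.nat_pow_closed car by blast
    hence "f [^]\<^bsub>AutoGroup G\<^esub> Suc k = compose (carrier G) (f [^]\<^bsub>AutoGroup G\<^esub> k) f"
      using Bij assms(4) by (simp add: AutoGroup_def BijGroup_def)
    also have "\<dots> = restrict (f ^^ Suc k) (carrier G)"
      unfolding Suc.IH using fG by (auto simp: compose_def funpow_swap1)
    finally show ?case .
  qed
  have "f [^]\<^bsub>AutoGroup G\<^esub> q = \<one>\<^bsub>AutoGroup G\<^esub>" unfolding pow one using iter by auto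
  hence "A.ord f dvd q" using A.pow_eq_id assms(4) car by simp
  moreover have "A.ord f \<noteq> 1" using A.ord_eq_1 assms(4) car nontriv by (auto simp: one)
  ultimately have "A.ord f = q" using assms(3) by (metis prime_nat_iff)
  thus ?thesis using A.ord_dvd_group_order assms(4) car by (metis order_AutoGroup)
qed

section \<open>Automorphisms of a direct product as matrices\<close>

lemma hom_eq_one_imp_inj:
  assumes "group G" "group H" "f \<in> hom G H"
    and "\<And>x. x \<in> carrier G \<Longrightarrow> f x = \<one>\<^bsub>H\<^esub> \<Longrightarrow> x = \<one>\<^bsub>G\<^esub>"
  shows "inj_on f (carrier G)"
proof -
  interpret group_hom G H f using assms by (auto simp: group_hom_def group_hom_axioms_def)
  show ?thesis using assms(4) by (intro trivial_ker_imp_inj) (auto simp: kernel_def)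
qed

lemma compose_auto:
  "group G \<Longrightarrow> f \<in> auto G \<Longrightarrow> h \<in> auto G \<Longrightarrow> compose (carrier G) f h \<in> auto G"
  by (auto simp: auto_def group.hom_compose compose_Bij)

lemma hom_facts:
  assumes "f \<in> hom G H" "group G" "group H"
  shows "f \<one>\<^bsub>G\<^esub> = \<one>\<^bsub>H\<^esub>" "x \<in> carrier G \<Longrightarrow> f x \<in> carrier H"
    "x \<in> carrier G \<Longrightarrow> f (x [^]\<^bsub>G\<^esub> (n::nat)) = f x [^]\<^bsub>H\<^esub> n"
  using assms hom_one hom_in_carrier hom_nat_pow by metis+

lemma inj_endo_image_eq:
  assumes "inj_on \<beta> S" "finite S" "\<beta> ` S \<subseteq> S"
  shows "\<beta> ` S = S"
  using assms endo_inj_surj by blast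

text \<open>
  Endomorphisms of $C \times D$ are matrices with entries $\alpha : C \to C$, $h : D \to C$,
  $k : C \to D$ and $\beta : D \to D$. Those considered here preserve $C \times N$ for a subgroup $N$
  of $D$: $k$ has values in $N$, and $\beta$ maps $N$ to itself. The hypothesis \<open>kill\<close> says that
  such $k$ vanish on elements killed by an exponent $e$ of $N$.
  In particular $k$ vanishes on images of elements of $N$, so that the off-diagonal entries do not
  affect invertibility: the matrix is invertible exactly when $\alpha$ and $\beta$ are. Consequently the
  stabilizer of $C \times N$ can be counted entry by entry. For trivial $N$ these are the triangular
  matrices.
\<close>

locale block_matrices = C: comm_group C + D: comm_group D
  for C :: "('a, 'c) monoid_scheme" (structure) and D :: "('b, 'd) monoid_scheme" (structure) +
  fixes N :: "'b set" and e :: nat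
  assumes finC: "finite (carrier C)" and finD: "finite (carrier D)"
    and N: "subgroup N D"
    and N_exp: "\<And>x. x \<in> N \<Longrightarrow> x [^]\<^bsub>D\<^esub> e = \<one>\<^bsub>D\<^esub>"
    and kill: "\<And>k c. k \<in> hom C D \<Longrightarrow> k ` carrier C \<subseteq> N \<Longrightarrow> c \<in> carrier C \<Longrightarrow>
      c [^]\<^bsub>C\<^esub> e = \<one>\<^bsub>C\<^esub> \<Longrightarrow> k c = \<one>\<^bsub>D\<^esub>"
begin

abbreviation P where "P \<equiv> C \<times>\<times> D"

definition stab where
  "stab = {\<sigma> \<in> auto P. \<sigma> ` (carrier C \<times> N) \<subseteq> carrier C \<times> N}"

definition blocks where
  "blocks = auto C \<times> homs D C \<times> {k \<in> homs C D. k ` carrier C \<subseteq> N} \<times> {\<beta> \<in> auto D. \<beta> ` N \<subseteq> N}"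

definition assemble where
  "assemble = (\<lambda>(\<alpha>, h, k, \<beta>). \<lambda>(c, d) \<in> carrier C \<times> carrier D.
     (\<alpha> c \<otimes>\<^bsub>C\<^esub> h d, k c \<otimes>\<^bsub>D\<^esub> \<beta> d))"

lemma ND: "x \<in> N \<Longrightarrow> x \<in> carrier D" using N subgroup.subset by blast
lemma N1: "\<one>\<^bsub>D\<^esub> \<in> N" using N by (rule subgroup.one_closed)
lemma group_P: "group P" by (intro DirProd_group C.is_group D.is_group)
lemma fin_P: "finite (carrier P)" using finC finD by simp

text \<open>
  The point is injectivity. If $(c, d)$ is in the kernel, then $\beta d$ is in $N$ and hence so is $d$.
  Thus $d$, then $\alpha c$, then $c$ are killed by $e$, so $k c$ is trivial, and the matrix acts on
  $(c, d)$ like a triangular one.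
\<close>

lemma assemble_in_stab:
  assumes "m \<in> blocks"
  shows "assemble m \<in> stab"
proof -
  obtain \<alpha> h k \<beta> where m: "m = (\<alpha>, h, k, \<beta>)" by (cases m)
  have \<alpha>: "\<alpha> \<in> auto C" and h: "h \<in> hom D C" and k: "k \<in> hom C D" "k ` carrier C \<subseteq> N"
    and \<beta>: "\<beta> \<in> auto D" "\<beta> ` N \<subseteq> N"
    using assms by (auto simp: blocks_def m homs_def)
  note \<alpha>' = autoD[OF \<alpha>] and \<beta>' = autoD[OF \<beta>(1)]
  note fa = hom_facts[OF \<alpha>'(1) C.is_group C.is_group] and fh = hom_facts[OF h D.is_group C.is_group]
    and fk = hom_facts[OF k(1) C.is_group D.is_group] and fb = hom_facts[OF \<beta>'(1) D.is_group D.is_group]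
  let ?s = "assemble m"
  have s: "?s (c, d) = (\<alpha> c \<otimes>\<^bsub>C\<^esub> h d, k c \<otimes>\<^bsub>D\<^esub> \<beta> d)" if "c \<in> carrier C" "d \<in> carrier D" for c d
    using that by (simp add: assemble_def m)
  have hom: "?s \<in> hom P P"
  proof (rule homI)
    fix x assume "x \<in> carrier P"
    thus "?s x \<in> carrier P" using fa(2) fh(2) fk(2) fb(2) by (auto simp: s)
  next
    fix x y assume "x \<in> carrier P" "y \<in> carrier P"
    then obtain c d c' d' where xy: "x = (c, d)" "y = (c', d')" "c \<in> carrier C" "c' \<in> carrier C"
      "d \<in> carrier D" "d' \<in> carrier D" by auto
    thus "?s (x \<otimes>\<^bsub>P\<^esub> y) = ?s x \<otimes>\<^bsub>P\<^esub> ?s y"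
      using fa(2) fh(2) fk(2) fb(2)
      by (simp add: s hom_mult[OF \<alpha>'(1)] hom_mult[OF \<beta>'(1)] hom_mult[OF h] hom_mult[OF k(1)]
          C.m_ac D.m_ac)
  qed
  have \<beta>N: "\<beta> ` N = N"
    using \<beta> \<beta>'(2) ND finD by (intro inj_endo_image_eq) (auto intro: inj_on_subset finite_subset)
  have "inj_on ?s (carrier P)"
  proof (rule hom_eq_one_imp_inj[OF group_P group_P hom])
    fix x assume x: "x \<in> carrier P" "?s x = \<one>\<^bsub>P\<^esub>"
    then obtain c d where cd: "x = (c, d)" "c \<in> carrier C" "d \<in> carrier D" by auto
    have 1: "\<alpha> c \<otimes>\<^bsub>C\<^esub> h d = \<one>\<^bsub>C\<^esub>" and 2: "k c \<otimes>\<^bsub>D\<^esub> \<beta> d = \<one>\<^bsub>D\<^esub>" using x cd by (auto simp: s)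
    note cl = fa(2)[OF cd(2)] fh(2)[OF cd(3)] fk(2)[OF cd(2)] fb(2)[OF cd(3)]
    have "\<beta> d = inv\<^bsub>D\<^esub> (k c)" using 2 cl by (metis D.inv_equality D.m_comm)
    also have "\<dots> \<in> N" using k(2) cd N by (auto intro: subgroup.m_inv_closed)
    finally have "\<beta> d \<in> \<beta> ` N" using \<beta>N by simp
    then obtain n where n: "n \<in> N" "\<beta> n = \<beta> d" by auto
    hence "d \<in> N" using \<beta>'(2) cd ND by (metis inj_onD)
    hence "d [^]\<^bsub>D\<^esub> e = \<one>\<^bsub>D\<^esub>" by (rule N_exp)
    hence he: "h d [^]\<^bsub>C\<^esub> e = \<one>\<^bsub>C\<^esub>" using fh(1) fh(3)[OF cd(3), of e] by simp
    have "(\<alpha> c \<otimes>\<^bsub>C\<^esub> h d) [^]\<^bsub>C\<^esub> e = \<one>\<^bsub>C\<^esub>" using 1 by simp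
    hence "\<alpha> c [^]\<^bsub>C\<^esub> e = \<one>\<^bsub>C\<^esub>" using he cl by (simp add: C.pow_mult_distrib C.m_comm)
    hence "\<alpha> (c [^]\<^bsub>C\<^esub> e) = \<alpha> \<one>\<^bsub>C\<^esub>" using fa(1) fa(3)[OF cd(2), of e] by simp
    hence "c [^]\<^bsub>C\<^esub> e = \<one>\<^bsub>C\<^esub>" using \<alpha>'(2) cd by (metis C.nat_pow_closed C.one_closed inj_onD)
    hence kc: "k c = \<one>\<^bsub>D\<^esub>" using kill k cd by blast
    hence "\<beta> d = \<beta> \<one>\<^bsub>D\<^esub>" using 2 cl fb(1) by simp
    hence d: "d = \<one>\<^bsub>D\<^esub>" using \<beta>'(2) cd by (metis D.one_closed inj_onD)
    hence "\<alpha> c = \<alpha> \<one>\<^bsub>C\<^esub>" using 1 cl fa(1) fh(1) by simp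
    hence "c = \<one>\<^bsub>C\<^esub>" using \<alpha>'(2) cd by (metis C.one_closed inj_onD)
    thus "x = \<one>\<^bsub>P\<^esub>" using d cd by simp
  qed
  moreover have "?s \<in> extensional (carrier P)" by (auto simp: assemble_def m extensional_def)
  ultimately have "?s \<in> auto P" using hom fin_P by (intro autoI)
  moreover have "?s ` (carrier C \<times> N) \<subseteq> carrier C \<times> N"
    using fa(2) fh(2) k(2) \<beta>(2) ND
    by (auto simp: s image_subset_iff intro!: subgroup.m_closed[OF N])
  ultimately show ?thesis by (simp add: stab_def)
qed

lemma assemble_inj: "inj_on assemble blocks"
proof (rule inj_onI)
  fix m m' assume mm: "m \<in> blocks" "m' \<in> blocks" "assemble m = assemble m'"
  obtain \<alpha> h k \<beta> \<alpha>' h' k' \<beta>' where m: "m = (\<alpha>, h, k, \<beta>)" "m' = (\<alpha>', h', k', \<beta>')"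
    by (cases m, cases m')
  have A: "\<alpha> \<in> hom C C" "\<alpha>' \<in> hom C C" "h \<in> hom D C" "h' \<in> hom D C"
    "k \<in> hom C D" "k' \<in> hom C D" "\<beta> \<in> hom D D" "\<beta>' \<in> hom D D"
    and ext: "\<alpha> \<in> extensional (carrier C)" "\<alpha>' \<in> extensional (carrier C)"
    "h \<in> extensional (carrier D)" "h' \<in> extensional (carrier D)"
    "k \<in> extensional (carrier C)" "k' \<in> extensional (carrier C)"
    "\<beta> \<in> extensional (carrier D)" "\<beta>' \<in> extensional (carrier D)"
    using mm by (auto simp: blocks_def m homs_def dest: autoD)
  have o: "\<alpha> \<one>\<^bsub>C\<^esub> = \<one>\<^bsub>C\<^esub>" "\<alpha>' \<one>\<^bsub>C\<^esub> = \<one>\<^bsub>C\<^esub>" "h \<one>\<^bsub>D\<^esub> = \<one>\<^bsub>C\<^esub>" "h' \<one>\<^bsub>D\<^esub> = \<one>\<^bsub>C\<^esub>"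
    "k \<one>\<^bsub>C\<^esub> = \<one>\<^bsub>D\<^esub>" "k' \<one>\<^bsub>C\<^esub> = \<one>\<^bsub>D\<^esub>" "\<beta> \<one>\<^bsub>D\<^esub> = \<one>\<^bsub>D\<^esub>" "\<beta>' \<one>\<^bsub>D\<^esub> = \<one>\<^bsub>D\<^esub>"
    using A by (auto intro!: hom_one C.is_group D.is_group)
  have c: "\<alpha> c = \<alpha>' c \<and> k c = k' c" if "c \<in> carrier C" for c
    using fun_cong[OF mm(3), of "(c, \<one>\<^bsub>D\<^esub>)"] that
    by (simp add: assemble_def m o hom_in_carrier[OF A(1)] hom_in_carrier[OF A(2)]
      hom_in_carrier[OF A(5)] hom_in_carrier[OF A(6)])
  have d: "h d = h' d \<and> \<beta> d = \<beta>' d" if "d \<in> carrier D" for d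
    using fun_cong[OF mm(3), of "(\<one>\<^bsub>C\<^esub>, d)"] that
    by (simp add: assemble_def m o hom_in_carrier[OF A(3)] hom_in_carrier[OF A(4)]
      hom_in_carrier[OF A(7)] hom_in_carrier[OF A(8)])
  show "m = m'" using c d ext by (auto simp: m intro: extensionalityI)
qed

text \<open>
  Conversely, the diagonal entries of an automorphism $\sigma$ in the stabilizer are injective. If
  $\alpha c$ is trivial, then $\sigma(c, 1)$ lies in $N$; so $c$ is killed by $e$, and $k c$ is
  trivial too. If $\beta d$ is trivial, correct $d$ by an element of $C$ so that $\sigma$ maps it into
  $N$. As $\sigma$ permutes $C \times N$, this puts $d$ into $N$, and the same argument ends the
  proof.
\<close>

lemma stab_subset_assemble: "stab \<subseteq> assemble ` blocks"
proof
  fix \<sigma> assume \<sigma>: "\<sigma> \<in> stab"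
  have aut: "\<sigma> \<in> auto P" and st: "\<sigma> ` (carrier C \<times> N) \<subseteq> carrier C \<times> N" using \<sigma> by (auto simp: stab_def)
  note \<sigma>' = autoD[OF aut]
  have onto: "\<sigma> ` (carrier C \<times> N) = carrier C \<times> N"
    using \<sigma>'(2) st ND finC finD
    by (intro inj_endo_image_eq) (auto intro: inj_on_subset finite_subset intro!: finite_cartesian_product)
  define \<alpha> where "\<alpha> = (\<lambda>c\<in>carrier C. fst (\<sigma> (c, \<one>\<^bsub>D\<^esub>)))"
  define k where "k = (\<lambda>c\<in>carrier C. snd (\<sigma> (c, \<one>\<^bsub>D\<^esub>)))"
  define h where "h = (\<lambda>d\<in>carrier D. fst (\<sigma> (\<one>\<^bsub>C\<^esub>, d)))"
  define \<beta> where "\<beta> = (\<lambda>d\<in>carrier D. snd (\<sigma> (\<one>\<^bsub>C\<^esub>, d)))"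
  have cl: "fst (\<sigma> (c, d)) \<in> carrier C" "snd (\<sigma> (c, d)) \<in> carrier D"
    if "c \<in> carrier C" "d \<in> carrier D" for c d
    using hom_in_carrier[OF \<sigma>'(1), of "(c, d)"] that by (auto simp: mem_Times_iff)
  have mult: "fst (\<sigma> (c \<otimes>\<^bsub>C\<^esub> c', d \<otimes>\<^bsub>D\<^esub> d')) = fst (\<sigma> (c, d)) \<otimes>\<^bsub>C\<^esub> fst (\<sigma> (c', d'))"
    "snd (\<sigma> (c \<otimes>\<^bsub>C\<^esub> c', d \<otimes>\<^bsub>D\<^esub> d')) = snd (\<sigma> (c, d)) \<otimes>\<^bsub>D\<^esub> snd (\<sigma> (c', d'))"
    if "c \<in> carrier C" "d \<in> carrier D" "c' \<in> carrier C" "d' \<in> carrier D" for c d c' d'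
    using hom_mult[OF \<sigma>'(1), of "(c, d)" "(c', d')"] that by (simp_all add: mult_DirProd')
  have multC: "fst (\<sigma> (c \<otimes>\<^bsub>C\<^esub> c', \<one>\<^bsub>D\<^esub>)) = fst (\<sigma> (c, \<one>\<^bsub>D\<^esub>)) \<otimes>\<^bsub>C\<^esub> fst (\<sigma> (c', \<one>\<^bsub>D\<^esub>))"
    "snd (\<sigma> (c \<otimes>\<^bsub>C\<^esub> c', \<one>\<^bsub>D\<^esub>)) = snd (\<sigma> (c, \<one>\<^bsub>D\<^esub>)) \<otimes>\<^bsub>D\<^esub> snd (\<sigma> (c', \<one>\<^bsub>D\<^esub>))"
    if "c \<in> carrier C" "c' \<in> carrier C" for c c'
    using mult[of c "\<one>\<^bsub>D\<^esub>" c' "\<one>\<^bsub>D\<^esub>"] that by simp_all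
  have multD: "fst (\<sigma> (\<one>\<^bsub>C\<^esub>, d \<otimes>\<^bsub>D\<^esub> d')) = fst (\<sigma> (\<one>\<^bsub>C\<^esub>, d)) \<otimes>\<^bsub>C\<^esub> fst (\<sigma> (\<one>\<^bsub>C\<^esub>, d'))"
    "snd (\<sigma> (\<one>\<^bsub>C\<^esub>, d \<otimes>\<^bsub>D\<^esub> d')) = snd (\<sigma> (\<one>\<^bsub>C\<^esub>, d)) \<otimes>\<^bsub>D\<^esub> snd (\<sigma> (\<one>\<^bsub>C\<^esub>, d'))"
    if "d \<in> carrier D" "d' \<in> carrier D" for d d'
    using mult[of "\<one>\<^bsub>C\<^esub>" d "\<one>\<^bsub>C\<^esub>" d'] that by simp_all
  have homs: "\<alpha> \<in> hom C C" "h \<in> hom D C" "k \<in> hom C D" "\<beta> \<in> hom D D"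
    by (auto intro!: homI simp: \<alpha>_def h_def k_def \<beta>_def cl multC multD)
  note fa = hom_facts[OF homs(1) C.is_group C.is_group] and fh = hom_facts[OF homs(2) D.is_group C.is_group]
    and fk = hom_facts[OF homs(3) C.is_group D.is_group] and fb = hom_facts[OF homs(4) D.is_group D.is_group]
  have sC: "\<sigma> (c, \<one>\<^bsub>D\<^esub>) = (\<alpha> c, k c)" if "c \<in> carrier C" for c
    using that by (simp add: \<alpha>_def k_def)
  have sD: "\<sigma> (\<one>\<^bsub>C\<^esub>, d) = (h d, \<beta> d)" if "d \<in> carrier D" for d
    using that by (simp add: h_def \<beta>_def)
  have s: "\<sigma> (c, d) = (\<alpha> c \<otimes>\<^bsub>C\<^esub> h d, k c \<otimes>\<^bsub>D\<^esub> \<beta> d)" if "c \<in> carrier C" "d \<in> carrier D" for c d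
    using hom_mult[OF \<sigma>'(1), of "(c, \<one>\<^bsub>D\<^esub>)" "(\<one>\<^bsub>C\<^esub>, d)"] that sC[OF that(1)] sD[OF that(2)] by simp
  have s1: "c = \<one>\<^bsub>C\<^esub> \<and> d = \<one>\<^bsub>D\<^esub>" if "\<sigma> (c, d) = (\<one>\<^bsub>C\<^esub>, \<one>\<^bsub>D\<^esub>)" "c \<in> carrier C" "d \<in> carrier D" for c d
  proof -
    have "\<sigma> (\<one>\<^bsub>C\<^esub>, \<one>\<^bsub>D\<^esub>) = (\<one>\<^bsub>C\<^esub>, \<one>\<^bsub>D\<^esub>)" using s[of "\<one>\<^bsub>C\<^esub>" "\<one>\<^bsub>D\<^esub>"] fa(1) fh(1) fk(1) fb(1) by simp
    hence "(c, d) = (\<one>\<^bsub>C\<^esub>, \<one>\<^bsub>D\<^esub>)" using that by - (rule inj_onD[OF \<sigma>'(2)], auto)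
    thus ?thesis by simp
  qed
  have kN: "k ` carrier C \<subseteq> N" using st N1 by (force simp: k_def)
  have \<beta>N: "\<beta> ` N \<subseteq> N" using st ND by (force simp: \<beta>_def)
  have "inj_on \<alpha> (carrier C)"
  proof (rule hom_eq_one_imp_inj[OF C.is_group C.is_group homs(1)])
    fix c assume c: "c \<in> carrier C" "\<alpha> c = \<one>\<^bsub>C\<^esub>"
    have "k c [^]\<^bsub>D\<^esub> e = \<one>\<^bsub>D\<^esub>" using kN c N_exp by blast
    hence "\<sigma> (c [^]\<^bsub>C\<^esub> e, \<one>\<^bsub>D\<^esub>) = (\<one>\<^bsub>C\<^esub>, \<one>\<^bsub>D\<^esub>)" using c sC fa(3) fk(3) by simp
    hence "c [^]\<^bsub>C\<^esub> e = \<one>\<^bsub>C\<^esub>" using s1 c by auto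
    hence "k c = \<one>\<^bsub>D\<^esub>" using kill homs(3) kN c by blast
    hence "\<sigma> (c, \<one>\<^bsub>D\<^esub>) = (\<one>\<^bsub>C\<^esub>, \<one>\<^bsub>D\<^esub>)" using c sC by simp
    thus "c = \<one>\<^bsub>C\<^esub>" using s1 c by auto
  qed
  hence \<alpha>: "\<alpha> \<in> auto C" using homs finC by (intro autoI) (auto simp: \<alpha>_def)
  have "inj_on \<beta> (carrier D)"
  proof (rule hom_eq_one_imp_inj[OF D.is_group D.is_group homs(4)])
    fix d assume d: "d \<in> carrier D" "\<beta> d = \<one>\<^bsub>D\<^esub>"
    have "h d \<in> \<alpha> ` carrier C" using fh(2)[OF d(1)] autoD(3)[OF \<alpha>] by simp
    then obtain c where c: "c \<in> carrier C" "\<alpha> c = h d" by auto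
    let ?c = "inv\<^bsub>C\<^esub> c"
    have ac: "\<alpha> ?c \<otimes>\<^bsub>C\<^esub> h d = \<one>\<^bsub>C\<^esub>"
      using hom_mult[OF homs(1), of ?c c] c fa(1) by simp
    have sd: "\<sigma> (?c, d) = (\<one>\<^bsub>C\<^esub>, k ?c)" using s[of ?c d] c d ac fk(2)[of ?c] by simp
    hence "\<sigma> (?c, d) \<in> \<sigma> ` (carrier C \<times> N)" unfolding onto using kN c by auto
    then obtain c' n where "c' \<in> carrier C" "n \<in> N" "\<sigma> (c', n) = \<sigma> (?c, d)" by auto
    hence "(c', n) = (?c, d)" using c d ND by - (rule inj_onD[OF \<sigma>'(2)], auto)
    hence "d \<in> N" using \<open>n \<in> N\<close> by simp
    hence "d [^]\<^bsub>D\<^esub> e = \<one>\<^bsub>D\<^esub>" by (rule N_exp)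
    hence "h d [^]\<^bsub>C\<^esub> e = \<one>\<^bsub>C\<^esub>" using fh(1) fh(3)[OF d(1), of e] by simp
    hence "\<alpha> (c [^]\<^bsub>C\<^esub> e) = \<alpha> \<one>\<^bsub>C\<^esub>" using fa(1) fa(3)[OF c(1), of e] c by simp
    hence "c [^]\<^bsub>C\<^esub> e = \<one>\<^bsub>C\<^esub>"
      using autoD(2)[OF \<alpha>] c by (metis C.nat_pow_closed C.one_closed inj_onD)
    hence "?c [^]\<^bsub>C\<^esub> e = \<one>\<^bsub>C\<^esub>" using c by (simp add: C.nat_pow_inv)
    hence "k ?c = \<one>\<^bsub>D\<^esub>" using kill homs(3) kN c by blast
    hence "\<sigma> (?c, d) = (\<one>\<^bsub>C\<^esub>, \<one>\<^bsub>D\<^esub>)" using sd by simp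
    thus "d = \<one>\<^bsub>D\<^esub>" using s1 c d by blast
  qed
  hence \<beta>: "\<beta> \<in> auto D" using homs finD by (intro autoI) (auto simp: \<beta>_def)
  have "(\<alpha>, h, k, \<beta>) \<in> blocks"
    using \<alpha> \<beta> homs kN \<beta>N by (auto simp: blocks_def homs_def h_def k_def)
  moreover have "\<sigma> = assemble (\<alpha>, h, k, \<beta>)"
    by (rule extensionalityI[OF \<sigma>'(4)]) (auto simp: assemble_def s)
  ultimately show "\<sigma> \<in> assemble ` blocks" by blast
qed

text \<open>
  Lagrange's theorem for the stabilizer of $C \times N$.
\<close>

theorem card_blocks_dvd:
  "card (auto C) * card (homs D C) * card {k \<in> homs C D. k ` carrier C \<subseteq> N}
     * card {\<beta> \<in> auto D. \<beta> ` N \<subseteq> N} dvd card (auto P)"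
proof -
  have "assemble ` blocks = stab" using assemble_in_stab stab_subset_assemble by blast
  hence "card stab = card blocks" using card_image[OF assemble_inj] by simp
  also have "\<dots> = card (auto C) * card (homs D C) * card {k \<in> homs C D. k ` carrier C \<subseteq> N}
     * card {\<beta> \<in> auto D. \<beta> ` N \<subseteq> N}"
    by (simp add: blocks_def card_cartesian_product)
  moreover have "card stab dvd card (auto P)"
  proof (rule card_dvd_card_auto[OF group_P fin_P])
    show "stab \<subseteq> auto P" by (auto simp: stab_def)
    have "(\<lambda>x\<in>carrier P. x) \<in> stab"
      using group.id_in_auto[OF group_P] ND by (auto simp: stab_def)
    thus "stab \<noteq> {}" by blast
    fix f g assume fg: "f \<in> stab" "g \<in> stab"
    have "compose (carrier P) f g \<in> auto P"
      using fg by (intro compose_auto[OF group_P]) (auto simp: stab_def)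
    moreover have "compose (carrier P) f g ` (carrier C \<times> N) \<subseteq> carrier C \<times> N"
      using fg ND by (fastforce simp: stab_def compose_def)
    ultimately show "compose (carrier P) f g \<in> stab" by (simp add: stab_def)
  qed
  ultimately show ?thesis by simp
qed

end

section \<open>Cyclic factors and automorphism groups of 2-groups\<close>

lemma order_DirProd: "order (C \<times>\<times> D) = order C * order D"
  by (simp add: order_def card_cartesian_product)

context finite_cyclic
begin

text \<open>
  A cyclic group of order $n$ is obtained from its trivial subgroup by a single extension step, in
  which the order of the generator modulo that subgroup is $n$.
\<close>

lemma hom_from_generator:
  assumes "comm_group D" "d \<in> carrier D" "d [^]\<^bsub>D\<^esub> order C = \<one>\<^bsub>D\<^esub>"
  shows "\<exists>k \<in> homs C D. k g = d"
proof -
  interpret D: comm_group D by fact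
  interpret C: comm_group C by (rule comm)
  have min: "g [^] i \<notin> {\<one>}" if "0 < i" "i < order C" for i :: nat
    using that gen_closed by (auto simp: pow_eq_id order_eq dest: dvd_imp_le)
  interpret S: hom_step C D "{\<one>}" g "order C" "\<lambda>_. \<one>\<^bsub>D\<^esub>"
    using finite_carrier gen_closed order_pos min C.comm_group_axioms D.comm_group_axioms
    by (intro hom_step.intro hom_step_axioms.intro)
       (auto simp: triv_subgroup order_eq hom_def)
  have "S.K = carrier C" using gen gen_closed by (force simp: S.K_def)
  hence "\<exists>F \<in> hom C D. F g = d" using S.extend[of d] assms by auto
  then obtain F where "F \<in> hom C D" "F g = d" by blast
  thus ?thesis using homsI[of F C D] gen_closed is_group by (intro bexI[of _ "restrict F (carrier C)"]) auto
qed

lemma hom_pow_generator: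
  assumes "k \<in> hom C D" "group D"
  shows "k (g [^] (i::nat)) = k g [^]\<^bsub>D\<^esub> i"
  using hom_facts(3)[OF assms(1) is_group assms(2) gen_closed] .

lemma homs_eqI:
  assumes "k \<in> homs C D" "k' \<in> homs C D" "group D" "k g = k' g"
  shows "k = k'"
proof (rule extensionalityI)
  fix c assume "c \<in> carrier C"
  then obtain i :: nat where i: "c = g [^] i" using gen by blast
  show "k c = k' c"
    unfolding i using assms hom_pow_generator[of k D i] hom_pow_generator[of k' D i]
    by (simp add: homs_def)
qed (use assms in \<open>auto simp: homs_def\<close>)

lemma card_homs_into_subgroup:
  assumes "comm_group D" "subgroup N D" "\<And>x. x \<in> N \<Longrightarrow> x [^]\<^bsub>D\<^esub> order C = \<one>\<^bsub>D\<^esub>"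
  shows "card {k \<in> homs C D. k ` carrier C \<subseteq> N} = card N"
proof (rule bij_betw_same_card[of "\<lambda>k. k g"], rule bij_betw_imageI)
  interpret D: comm_group D by fact
  show "inj_on (\<lambda>k. k g) {k \<in> homs C D. k ` carrier C \<subseteq> N}"
    by (rule inj_onI) (use homs_eqI D.is_group in blast)
  show "(\<lambda>k. k g) ` {k \<in> homs C D. k ` carrier C \<subseteq> N} = N"
  proof (intro equalityI subsetI)
    fix x assume x: "x \<in> N"
    then obtain k where k: "k \<in> homs C D" "k g = x"
      using hom_from_generator[OF assms(1), of x] assms subgroup.mem_carrier by metis
    interpret N: group "D\<lparr>carrier := N\<rparr>" using assms(2) D.subgroup_imp_group by blast
    have "k (g [^] (i::nat)) \<in> N" for i
      using k x N.nat_pow_closed[of x i] D.is_group hom_pow_generator[of k D i]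
      by (simp add: homs_def D.nat_pow_consistent[symmetric])
    hence "k ` carrier C \<subseteq> N" using gen by blast
    thus "x \<in> (\<lambda>k. k g) ` {k \<in> homs C D. k ` carrier C \<subseteq> N}" using k by blast
  qed (use gen_closed in auto)
qed

text \<open>
  An automorphism is determined by the image of the generator, which can be any element of full order.
\<close>

lemma card_auto: "card (auto C) = totient (order C)"
proof -
  let ?n = "order C"
  have "bij_betw (\<lambda>\<sigma>. \<sigma> g) (auto C) {c \<in> carrier C. ord c = ?n}"
  proof (rule bij_betw_imageI)
    have sub: "auto C \<subseteq> homs C C" by (auto simp: homs_def dest: autoD)
    show "inj_on (\<lambda>\<sigma>. \<sigma> g) (auto C)"
      by (rule inj_onI) (use homs_eqI sub is_group in blast)
    show "(\<lambda>\<sigma>. \<sigma> g) ` auto C = {c \<in> carrier C. ord c = ?n}"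
    proof (intro equalityI subsetI)
      fix c assume "c \<in> (\<lambda>\<sigma>. \<sigma> g) ` auto C"
      then obtain \<sigma> where s: "\<sigma> \<in> auto C" "c = \<sigma> g" by auto
      note s' = autoD[OF s(1)]
      have c: "c \<in> carrier C" using hom_in_carrier[OF s'(1) gen_closed] s by simp
      have "c [^] i = \<one> \<longleftrightarrow> ord g dvd i" for i :: nat
      proof -
        have "c [^] i = \<one> \<longleftrightarrow> \<sigma> (g [^] i) = \<sigma> \<one>"
          using hom_pow_generator[OF s'(1) is_group] s hom_one[OF s'(1) is_group is_group] by simp
        also have "\<dots> \<longleftrightarrow> g [^] i = \<one>"
          using s'(2) gen_closed by (auto simp: inj_on_def)
        finally show ?thesis using pow_eq_id gen_closed by simp
      qed
      hence "ord c = ?n" using ord_unique[OF c] by (simp add: order_eq)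
      thus "c \<in> {c \<in> carrier C. ord c = ?n}" using c by simp
    next
      fix c assume c: "c \<in> {c \<in> carrier C. ord c = ?n}"
      then obtain k where k: "k \<in> homs C C" "k g = c"
        using hom_from_generator[OF comm, of c] by (auto simp: pow_eq_id)
      have khom: "k \<in> hom C C" using k by (simp add: homs_def)
      have "inj_on k (carrier C)"
      proof (rule hom_eq_one_imp_inj[OF is_group is_group khom])
        fix x assume x: "x \<in> carrier C" "k x = \<one>"
        then obtain i :: nat where i: "x = g [^] i" using gen by blast
        hence "c [^] i = \<one>" using hom_pow_generator[OF khom is_group] k x by simp
        hence "ord g dvd i" using c pow_eq_id by (simp add: order_eq)
        thus "x = \<one>" using i gen_closed pow_eq_id by simp
      qed
      hence "k \<in> auto C" using k khom finite_carrier by (intro autoI) (auto simp: homs_def)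
      thus "c \<in> (\<lambda>\<sigma>. \<sigma> g) ` auto C" using k by blast
    qed
  qed
  hence "card (auto C) = card {c \<in> carrier C. ord c = ?n}" by (rule bij_betw_same_card)
  also have "\<dots> = card (totatives ?n)"
  proof (rule sym, rule bij_betw_same_card[of "\<lambda>i. g [^] i"], rule bij_betw_imageI)
    show "inj_on (\<lambda>i. g [^] i) (totatives ?n)"
      using ord_inj'[OF gen_closed] by (rule inj_on_subset) (auto simp: totatives_def order_eq)
    show "(\<lambda>i. g [^] i) ` totatives ?n = {c \<in> carrier C. ord c = ?n}"
    proof (intro equalityI subsetI)
      fix c assume "c \<in> (\<lambda>i. g [^] i) ` totatives ?n"
      thus "c \<in> {c \<in> carrier C. ord c = ?n}"
        using pow_ord_eq_ord_iff[OF finite_carrier gen_closed] gen_closed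
        by (auto simp: totatives_def order_eq)
    next
      fix c assume c: "c \<in> {c \<in> carrier C. ord c = ?n}"
      then obtain i :: nat where i: "c = g [^] i" using gen by blast
      \<comment> \<open>Totatives of $n$ lie between 1 and $n$, so the residue 0 is represented by $n$. This matters for the trivial group.\<close>
      define j where "j = (if i mod ?n = 0 then ?n else i mod ?n)"
      have "g [^] i = g [^] (i mod ?n)"
      proof -
        have "g [^] i = g [^] (i mod ?n) \<otimes> (g [^] ?n) [^] (i div ?n)"
          using gen_closed by (simp add: nat_pow_pow nat_pow_mult)
        thus ?thesis using gen_closed by (simp add: order_eq)
      qed
      hence cj: "c = g [^] j" using i gen_closed by (simp add: j_def order_eq)
      have j: "0 < j" "j \<le> ?n" using order_pos by (auto simp: j_def less_imp_le)
      have "coprime j ?n"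
        using pow_ord_eq_ord_iff[OF finite_carrier gen_closed, of j] c cj by (simp add: order_eq)
      thus "c \<in> (\<lambda>i. g [^] i) ` totatives ?n" using j cj by (auto simp: totatives_def)
    qed
  qed
  finally show ?thesis by (simp add: totient_def)
qed

lemma totient_dvd_card_auto_prod:
  assumes D: "comm_group D" "finite (carrier D)"
    and expo: "\<And>d. d \<in> carrier D \<Longrightarrow> d [^]\<^bsub>D\<^esub> order C = \<one>\<^bsub>D\<^esub>"
  shows "totient (order C) * card (auto D) * order D dvd card (auto (C \<times>\<times> D))"
proof -
  interpret C: comm_group C by (rule comm)
  interpret D: comm_group D by fact
  interpret block_matrices C D "{\<one>\<^bsub>D\<^esub>}" 1
    by unfold_locales (use finite_carrier D D.triv_subgroup in \<open>auto simp: subgroup_def\<close>)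
  have "card {k \<in> homs C D. k ` carrier C \<subseteq> {\<one>\<^bsub>D\<^esub>}} = card {\<one>\<^bsub>D\<^esub>}"
    by (rule card_homs_into_subgroup[OF D(1) D.triv_subgroup]) auto
  moreover have "{\<beta> \<in> auto D. \<beta> ` {\<one>\<^bsub>D\<^esub>} \<subseteq> {\<one>\<^bsub>D\<^esub>}} = auto D"
    using hom_one[OF autoD(1) D.is_group D.is_group] by auto
  moreover have "card (homs D C) = order D"
    using card_homs_into_cyclic[OF D finite_cyclic_axioms expo] by (simp add: order_def)
  ultimately show ?thesis using card_blocks_dvd by (simp add: card_auto mult.assoc mult.left_commute mult.commute)
qed

end

text \<open>
  Inversion is an automorphism whose square is the identity, so it must be the identity when the
  automorphism group has odd order.
\<close>

lemma odd_card_auto_imp_involutive: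
  assumes "comm_group D" "finite (carrier D)" "odd (card (auto D))" "x \<in> carrier D"
  shows "x [^]\<^bsub>D\<^esub> (2::nat) = \<one>\<^bsub>D\<^esub>"
proof (rule ccontr)
  interpret D: comm_group D by fact
  assume neq: "x [^]\<^bsub>D\<^esub> (2::nat) \<noteq> \<one>\<^bsub>D\<^esub>"
  let ?f = "restrict (m_inv D) (carrier D)"
  have "?f \<in> auto D"
    by (rule autoI) (auto simp: hom_def D.inv_mult inj_on_def assms(2))
  moreover have "(?f ^^ 2) y = y" if "y \<in> carrier D" for y
    using that by (simp add: numeral_2_eq_2)
  moreover have "?f x \<noteq> x"
  proof
    assume "?f x = x"
    hence "x \<otimes>\<^bsub>D\<^esub> x = \<one>\<^bsub>D\<^esub>" using assms(4) D.r_inv[of x] by simp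
    thus False using neq assms(4) by (simp add: numeral_2_eq_2)
  qed
  ultimately have "2 dvd card (auto D)"
    using assms by (intro prime_dvd_card_auto[OF D.is_group, where f = ?f]) auto
  thus False using assms by simp
qed

text \<open>
  For a prime $q$ dividing the order, Sylow's theorem provides a subgroup of order $q$, hence an
  element of order $q$, which must divide the exponent $2^b$.
\<close>

lemma order_power_of_two:
  assumes "group G" "finite (carrier G)" "\<And>x. x \<in> carrier G \<Longrightarrow> x [^]\<^bsub>G\<^esub> (2 ^ b :: nat) = \<one>\<^bsub>G\<^esub>"
  obtains a where "order G = 2 ^ a"
proof -
  interpret G: group G by fact
  have pos: "order G > 0" using assms(2) by (simp add: G.order_gt_0_iff_finite)
  have "q = 2" if q: "Factorial_Ring.prime q" "q dvd order G" for q :: nat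
  proof -
    obtain m where "order G = q ^ 1 * m" using q by auto
    then obtain H where H: "subgroup H G" "card H = q"
      using sylow_thm[of q G 1 m] q assms by auto
    have "q > 1" using q prime_gt_1_nat by blast
    have "H \<noteq> {\<one>\<^bsub>G\<^esub>}" using H \<open>q > 1\<close> by auto
    then obtain h where h: "h \<in> H" "h \<noteq> \<one>\<^bsub>G\<^esub>" using H(1) subgroup.one_closed by blast
    have hG: "h \<in> carrier G" using h H subgroup.mem_carrier by metis
    have "h [^]\<^bsub>G\<^esub> q = \<one>\<^bsub>G\<^esub>"
    proof -
      interpret H: group "G\<lparr>carrier := H\<rparr>" using H G.subgroup_imp_group by blast
      show ?thesis using H.pow_order_eq_1[of h] h H
        by (simp add: order_def G.nat_pow_consistent[symmetric])
    qed
    hence "G.ord h dvd q" using hG by (simp add: G.pow_eq_id)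
    moreover have "G.ord h \<noteq> 1" using hG h G.ord_eq_1 by blast
    ultimately have "G.ord h = q" using q by (metis prime_nat_iff)
    moreover have "G.ord h dvd 2 ^ b" using assms(3)[OF hG] hG by (simp add: G.pow_eq_id)
    ultimately show "q = 2" using q by (metis prime_dvd_power primes_dvd_imp_eq two_is_prime_nat)
  qed
  note primes = this
  obtain m where m: "order G = 2 ^ multiplicity 2 (order G) * m" "\<not> 2 dvd m"
    using multiplicity_decompose'[of "order G" "2::nat"] pos by auto
  have "m = 1"
  proof (rule ccontr)
    assume "m \<noteq> 1"
    then obtain q where q: "Factorial_Ring.prime q" "q dvd m" using prime_factor_nat by blast
    hence "q dvd order G" using m(1) by (metis dvd_mult)
    with q m(2) primes show False by metis
  qed
  with m(1) have "order G = 2 ^ multiplicity 2 (order G)" by simp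
  thus thesis using that by blast
qed

text \<open>
  Split off a cyclic factor $C$ and use that $2 \phi(|C|) = |C|$ when $|C|$ is a nontrivial power of 2.
  The factor 2 is needed: nontrivial cyclic 2-groups have half as many automorphisms as elements.
\<close>

lemma two_group_order_dvd:
  fixes D :: "('a, 'b) monoid_scheme"
  assumes D: "comm_group D" "finite (carrier D)" "order D = 2 ^ a"
  shows "order D dvd 2 * card (auto D)"
proof -
  obtain C D' :: "('a, 'b) monoid_scheme" and g where
    C: "finite_cyclic C g" and D': "comm_group D'" "finite (carrier D')"
    and expo: "\<And>d. d \<in> carrier D' \<Longrightarrow> d [^]\<^bsub>D'\<^esub> order C = \<one>\<^bsub>D'\<^esub>"
    and iso: "C \<times>\<times> D' \<cong> D"
    using cyclic_direct_factor[OF D(1,2)] by metis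
  interpret finite_cyclic C g by fact
  interpret D: comm_group D by fact
  interpret D': comm_group D' by fact
  have ord: "order D = order C * order D'" using iso_same_order[OF _] iso order_DirProd
    by (metis iso_same_card order_def)
  have "order C dvd 2 ^ a" using ord D(3) by (metis dvd_triv_left)
  then obtain b where b: "order C = 2 ^ b" using divides_primepow_nat[of 2] two_is_prime_nat by blast
  have dvd: "totient (order C) * card (auto D') * order D' dvd card (auto D)"
    using totient_dvd_card_auto_prod[OF D' expo] card_auto_cong[OF iso]
      DirProd_group[OF is_group D'.is_group] D.is_group by simp
  show ?thesis
  proof (cases b)
    case 0
    hence "carrier D' \<subseteq> {\<one>\<^bsub>D'\<^esub>}" using expo b by auto
    hence "carrier D' = {\<one>\<^bsub>D'\<^esub>}" by auto
    thus ?thesis using ord b 0 by (simp add: order_def)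
  next
    case (Suc c)
    have n: "2 * totient (order C) = order C" using totient_power_Suc[of 2 c] b Suc by simp
    have "2 * (totient (order C) * card (auto D') * order D') dvd 2 * card (auto D)"
      using dvd by (rule mult_dvd_mono[OF dvd_refl])
    also have "2 * (totient (order C) * card (auto D') * order D')
        = (2 * totient (order C)) * order D' * card (auto D')" by (simp only: ac_simps)
    also have "\<dots> = order D * card (auto D')" by (simp only: n ord)
    finally show ?thesis by (rule dvd_mult_left)
  qed
qed

lemma small_group_card_auto:
  assumes "group D" "finite (carrier D)" "order D \<le> 2"
  shows "card (auto D) = 1"
proof -
  interpret D: group D by fact
  have "f = (\<lambda>x\<in>carrier D. x)" if f: "f \<in> auto D" for f
  proof (rule extensionalityI[of _ "carrier D"])
    note f' = autoD[OF f]
    fix x assume x: "x \<in> carrier D"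
    have one: "f \<one>\<^bsub>D\<^esub> = \<one>\<^bsub>D\<^esub>" using hom_one[OF f'(1) D.is_group D.is_group] .
    show "f x = (\<lambda>x\<in>carrier D. x) x"
    proof (cases "x = \<one>\<^bsub>D\<^esub>")
      case False
      have "f x \<noteq> \<one>\<^bsub>D\<^esub>" using one False x f'(2) by (metis D.one_closed inj_onD)
      moreover have "f x \<in> carrier D" using hom_in_carrier[OF f'(1) x] .
      ultimately have "card {\<one>\<^bsub>D\<^esub>, x, f x} \<le> card (carrier D)"
        using assms(2) x by - (rule card_mono, auto)
      hence "card {\<one>\<^bsub>D\<^esub>, x, f x} \<le> 2" using assms(3) by (simp add: order_def)
      hence "f x = x" using False \<open>f x \<noteq> \<one>\<^bsub>D\<^esub>\<close> by (auto simp: card_insert_if split: if_splits)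
      thus ?thesis using x by simp
    qed (use one x in auto)
  qed (use autoD[OF f] in auto)
  hence "auto D = {(\<lambda>x\<in>carrier D. x)}" using D.id_in_auto by blast
  thus ?thesis by simp
qed

context finite_cyclic
begin

text \<open>
  For trivial $D$ an automorphism is determined by the image of a generator. If $|D| = 2$, the
  nontrivial element of $D$ must also be mapped to an element of order 2. There are at most 3 such
  elements, as $C$ contains only two square roots of the neutral element; and the generator of $C$ is not
  mapped to the neutral element. This rules out odd primes as the quotient because they are at least 3.
\<close>

lemma card_auto_prod_small:
  assumes D: "comm_group D" "finite (carrier D)" "order D \<le> 2"
    and expo: "\<And>d. d \<in> carrier D \<Longrightarrow> d [^]\<^bsub>D\<^esub> order C = \<one>\<^bsub>D\<^esub>"
  shows "card (auto (C \<times>\<times> D)) < 3 * (order C * order D)"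
proof -
  interpret D: comm_group D by fact
  have grp: "group (C \<times>\<times> D)" by (rule DirProd_group[OF is_group D.is_group])
  have pos: "order C > 0" "order D > 0" using order_pos D by (auto simp: D.order_gt_0_iff_finite)
  hence pos': "order C * order D > 0" by simp
  have determined: "f = f'"
    if f: "f \<in> auto (C \<times>\<times> D)" "f' \<in> auto (C \<times>\<times> D)"
      and eq: "f (g, \<one>\<^bsub>D\<^esub>) = f' (g, \<one>\<^bsub>D\<^esub>)"
      and eqD: "\<And>d. d \<in> carrier D \<Longrightarrow> f (\<one>, d) = f' (\<one>, d)" for f f'
  proof (rule extensionalityI[OF autoD(4)[OF f(1)] autoD(4)[OF f(2)]])
    fix x assume "x \<in> carrier (C \<times>\<times> D)"
    then obtain c d where cd: "x = (c, d)" "c \<in> carrier C" "d \<in> carrier D" by auto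
    obtain i :: nat where i: "c = g [^] i" using gen cd by blast
    have pow: "(g, \<one>\<^bsub>D\<^esub>) [^]\<^bsub>C \<times>\<times> D\<^esub> j = (g [^] j, \<one>\<^bsub>D\<^esub>)" for j :: nat
      by (induction j) auto
    have "f (c, \<one>\<^bsub>D\<^esub>) = f' (c, \<one>\<^bsub>D\<^esub>)"
      using hom_nat_pow[OF autoD(1)[OF f(1)], of "(g, \<one>\<^bsub>D\<^esub>)" i]
        hom_nat_pow[OF autoD(1)[OF f(2)], of "(g, \<one>\<^bsub>D\<^esub>)" i] gen_closed grp eq i
      by (simp add: pow)
    thus "f x = f' x" using eqD[OF cd(3)] cd
        hom_mult[OF autoD(1)[OF f(1)], of "(c, \<one>\<^bsub>D\<^esub>)" "(\<one>, d)"]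
        hom_mult[OF autoD(1)[OF f(2)], of "(c, \<one>\<^bsub>D\<^esub>)" "(\<one>, d)"] by simp
  qed
  have one: "f (\<one>, \<one>\<^bsub>D\<^esub>) = (\<one>, \<one>\<^bsub>D\<^esub>)" if "f \<in> auto (C \<times>\<times> D)" for f
    using hom_one[OF autoD(1)[OF that] grp grp] by simp
  have fcl: "f x \<in> carrier C \<times> carrier D" if "f \<in> auto (C \<times>\<times> D)" "x \<in> carrier C \<times> carrier D" for f x
    using hom_in_carrier[OF autoD(1)[OF that(1)], of x] that by simp
  have fin: "finite (carrier C \<times> carrier D)" using finite_carrier D by simp
  have cardP: "card (carrier C \<times> carrier D) = order C * order D"
    by (simp add: order_def card_cartesian_product)
  consider "order D = 1" | "order D = 2" using D(3) pos by linarith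
  thus ?thesis
  proof cases
    case 1
    then obtain d where "carrier D = {d}" by (metis order_def card_1_singletonE)
    hence D1: "carrier D = {\<one>\<^bsub>D\<^esub>}" using D.one_closed by auto
    have "inj_on (\<lambda>f. f (g, \<one>\<^bsub>D\<^esub>)) (auto (C \<times>\<times> D))"
      by (rule inj_onI) (rule determined, auto simp: D1 one)
    hence "card (auto (C \<times>\<times> D)) \<le> card (carrier C \<times> carrier D)"
      using fcl gen_closed fin by (intro card_inj_on_le image_subsetI) auto
    thus ?thesis using pos' cardP by linarith
  next
    case 2
    then obtain a b where "carrier D = {a, b}" "a \<noteq> b" by (auto simp: order_def card_2_iff)
    then obtain d0 where D2: "carrier D = {\<one>\<^bsub>D\<^esub>, d0}" "d0 \<noteq> \<one>\<^bsub>D\<^esub>" using D.one_closed by auto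
    have d0: "d0 \<in> carrier D" using D2 by simp
    have dd: "d [^]\<^bsub>D\<^esub> (2::nat) = \<one>\<^bsub>D\<^esub>" if "d \<in> carrier D" for d
      using D.pow_order_eq_1[OF that] 2 by simp
    have "D.ord d0 = 2"
    proof -
      have "D.ord d0 dvd 2" using dd[OF d0] d0 by (simp add: D.pow_eq_id)
      moreover have "D.ord d0 \<noteq> 1" using D.ord_eq_1[OF d0] D2 by blast
      ultimately show ?thesis by (metis prime_nat_iff two_is_prime_nat)
    qed
    hence "2 dvd order C" using expo[OF d0] d0 by (simp add: D.pow_eq_id)
    then obtain n' where n': "order C = 2 * n'" by auto
    have roots: "card {c \<in> carrier C. c [^] (2::nat) = \<one>} = 2"
      by (rule card_roots[OF n']) auto
    have "g \<noteq> \<one>" using order_eq n' order_pos by auto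
    let ?R = "{c \<in> carrier C. c [^] (2::nat) = \<one>} \<times> carrier D"
    let ?T = "(carrier C \<times> carrier D - {(\<one>, \<one>\<^bsub>D\<^esub>)}) \<times> (?R - {(\<one>, \<one>\<^bsub>D\<^esub>)})"
    have finR: "finite ?R" using finite_carrier D by simp
    have "inj_on (\<lambda>f. (f (g, \<one>\<^bsub>D\<^esub>), f (\<one>, d0))) (auto (C \<times>\<times> D))"
      by (rule inj_onI) (rule determined, auto simp: D2 one)
    moreover have "(\<lambda>f. (f (g, \<one>\<^bsub>D\<^esub>), f (\<one>, d0))) ` auto (C \<times>\<times> D) \<subseteq> ?T"
    proof (rule image_subsetI)
      fix f assume f: "f \<in> auto (C \<times>\<times> D)"
      have 1: "f x \<noteq> (\<one>, \<one>\<^bsub>D\<^esub>)" if "x \<in> carrier C \<times> carrier D" "x \<noteq> (\<one>, \<one>\<^bsub>D\<^esub>)" for x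
        using autoD(2)[OF f] that one[OF f] by (metis one_closed D.one_closed carrier_DirProd inj_onD mem_Sigma_iff)
      obtain c d where cd: "f (\<one>, d0) = (c, d)" "c \<in> carrier C" "d \<in> carrier D"
        using fcl[OF f, of "(\<one>, d0)"] d0 by auto
      have "f ((\<one>, d0) \<otimes>\<^bsub>C \<times>\<times> D\<^esub> (\<one>, d0)) = (c \<otimes> c, d \<otimes>\<^bsub>D\<^esub> d)"
        using hom_mult[OF autoD(1)[OF f], of "(\<one>, d0)" "(\<one>, d0)"] cd d0 by simp
      hence "c \<otimes> c = \<one>" using dd[OF d0] d0 one[OF f] by (simp add: numeral_2_eq_2)
      hence "f (\<one>, d0) \<in> ?R" using cd by (simp add: numeral_2_eq_2)
      thus "(f (g, \<one>\<^bsub>D\<^esub>), f (\<one>, d0)) \<in> ?T"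
        using 1 fcl[OF f] gen_closed d0 \<open>g \<noteq> \<one>\<close> D2(2) by simp
    qed
    ultimately have "card (auto (C \<times>\<times> D)) \<le> card ?T"
      using fin finR by (intro card_inj_on_le) auto
    also have "\<dots> = (order C * order D - 1) * (2 * 2 - 1)"
      using fin finR cardP roots 2
      by (simp add: card_cartesian_product card_Diff_singleton order_def)
    also have "\<dots> < 3 * (order C * order D)" using pos' by simp
    finally show ?thesis .
  qed
qed

end

section \<open>Groups with a cofactor of order four\<close>

text \<open>
  Treats both groups of order 4 alike: $n$ is an element of order 2, and $d$ represents the other
  coset of the subgroup that $n$ generates.
\<close>

lemma order_four_decomp:
  assumes "comm_group D" "finite (carrier D)" "order D = 4"
  obtains n d where "n \<in> carrier D" "n \<noteq> \<one>\<^bsub>D\<^esub>" "n \<otimes>\<^bsub>D\<^esub> n = \<one>\<^bsub>D\<^esub>"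
    "d \<in> carrier D" "d \<noteq> \<one>\<^bsub>D\<^esub>" "d \<noteq> n"
    "carrier D = {\<one>\<^bsub>D\<^esub>, n, d, d \<otimes>\<^bsub>D\<^esub> n}" "d \<otimes>\<^bsub>D\<^esub> d \<in> {\<one>\<^bsub>D\<^esub>, n}"
    "d \<otimes>\<^bsub>D\<^esub> n \<notin> {\<one>\<^bsub>D\<^esub>, n, d}"
proof -
  interpret D: comm_group D by fact
  have "carrier D \<noteq> {\<one>\<^bsub>D\<^esub>}" using assms(3) by (auto simp: order_def)
  then obtain y where y: "y \<in> carrier D" "y \<noteq> \<one>\<^bsub>D\<^esub>" using D.one_closed by blast
  define n where "n = (if y \<otimes>\<^bsub>D\<^esub> y = \<one>\<^bsub>D\<^esub> then y else y \<otimes>\<^bsub>D\<^esub> y)"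
  have "y [^]\<^bsub>D\<^esub> (4::nat) = \<one>\<^bsub>D\<^esub>" using D.pow_order_eq_1[OF y(1)] assms(3) by simp
  hence "(y \<otimes>\<^bsub>D\<^esub> y) \<otimes>\<^bsub>D\<^esub> (y \<otimes>\<^bsub>D\<^esub> y) = \<one>\<^bsub>D\<^esub>"
    using y by (simp add: numeral_eq_Suc D.m_assoc)
  hence n: "n \<in> carrier D" "n \<noteq> \<one>\<^bsub>D\<^esub>" "n \<otimes>\<^bsub>D\<^esub> n = \<one>\<^bsub>D\<^esub>" using y by (auto simp: n_def)
  have "\<not> carrier D \<subseteq> {\<one>\<^bsub>D\<^esub>, n}"
  proof
    assume "carrier D \<subseteq> {\<one>\<^bsub>D\<^esub>, n}"
    hence "card (carrier D) \<le> card {\<one>\<^bsub>D\<^esub>, n}" by (rule card_mono[rotated]) simp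
    thus False using assms(3) n by (simp add: order_def)
  qed
  then obtain d where d: "d \<in> carrier D" "d \<noteq> \<one>\<^bsub>D\<^esub>" "d \<noteq> n" by blast
  have dn: "d \<otimes>\<^bsub>D\<^esub> n \<notin> {\<one>\<^bsub>D\<^esub>, n, d}"
  proof -
    have "d \<otimes>\<^bsub>D\<^esub> n \<noteq> \<one>\<^bsub>D\<^esub>"
    proof
      assume "d \<otimes>\<^bsub>D\<^esub> n = \<one>\<^bsub>D\<^esub>"
      hence "d \<otimes>\<^bsub>D\<^esub> n = n \<otimes>\<^bsub>D\<^esub> n" using n by simp
      thus False using d n(1) by (metis D.right_cancel)
    qed
    thus ?thesis using d n by simp
  qed
  have "{\<one>\<^bsub>D\<^esub>, n, d, d \<otimes>\<^bsub>D\<^esub> n} = carrier D"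
  proof (rule card_subset_eq)
    have "card {\<one>\<^bsub>D\<^esub>, n, d, d \<otimes>\<^bsub>D\<^esub> n} = 4" using d n dn by (auto simp: card_insert_if)
    thus "card {\<one>\<^bsub>D\<^esub>, n, d, d \<otimes>\<^bsub>D\<^esub> n} = card (carrier D)" using assms(3) by (simp add: order_def)
  qed (use d n assms in auto)
  hence car: "carrier D = {\<one>\<^bsub>D\<^esub>, n, d, d \<otimes>\<^bsub>D\<^esub> n}" by simp
  have "d \<otimes>\<^bsub>D\<^esub> d \<in> carrier D" using d by simp
  moreover have "d \<otimes>\<^bsub>D\<^esub> d \<noteq> d" "d \<otimes>\<^bsub>D\<^esub> d \<noteq> d \<otimes>\<^bsub>D\<^esub> n" using d n by simp_all
  ultimately have "d \<otimes>\<^bsub>D\<^esub> d \<in> {\<one>\<^bsub>D\<^esub>, n}" unfolding car by blast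
  thus thesis using that n d dn car by blast
qed

context finite_cyclic
begin

text \<open>
  For the subgroup $N$ of order 2 in $D$, the stabilizer of $C \times N$ has order $2\,|C|\,|D|$.
  With $|C| = 2^{b+2}$, the entries contribute $2^{b+1}$ for $\mathrm{Aut}(C)$, 4 for
  $\mathrm{Hom}(D,C)$, 2 for $\mathrm{Hom}(C,N)$, and 2 for the automorphisms of $D$ that preserve $N$.
  The assumption $|C| \ge 4$ enters because an element of $C$ killed by 2 is then a square, and so
  is killed by every homomorphism to $N$.
\<close>

lemma card_auto_prod_order_four:
  assumes D: "comm_group D" "finite (carrier D)" "order D = 4"
    and n: "order C = 2 ^ Suc (Suc b)"
  shows "2 * (order C * order D) dvd card (auto (C \<times>\<times> D))"
proof -
  interpret C: comm_group C by (rule comm)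
  interpret D: comm_group D by fact
  obtain n d where nd: "n \<in> carrier D" "n \<noteq> \<one>\<^bsub>D\<^esub>" "n \<otimes>\<^bsub>D\<^esub> n = \<one>\<^bsub>D\<^esub>"
    "d \<in> carrier D" "d \<noteq> \<one>\<^bsub>D\<^esub>" "d \<noteq> n"
    "carrier D = {\<one>\<^bsub>D\<^esub>, n, d, d \<otimes>\<^bsub>D\<^esub> n}" "d \<otimes>\<^bsub>D\<^esub> d \<in> {\<one>\<^bsub>D\<^esub>, n}"
    "d \<otimes>\<^bsub>D\<^esub> n \<notin> {\<one>\<^bsub>D\<^esub>, n, d}"
    by (rule order_four_decomp[OF D])
  have dnn: "d \<otimes>\<^bsub>D\<^esub> n \<otimes>\<^bsub>D\<^esub> n = d" using nd(1,3,4) by (simp add: D.m_assoc)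
  define N where "N = {\<one>\<^bsub>D\<^esub>, n}"
  have Nsub: "N \<subseteq> carrier D" using nd(1) by (simp add: N_def)
  have N: "subgroup N D"
    by (rule D.finite_closed_imp_subgroup[OF D(2) Nsub]) (use nd(1,3) in \<open>auto simp: N_def\<close>)
  have N2: "x [^]\<^bsub>D\<^esub> (2::nat) = \<one>\<^bsub>D\<^esub>" if "x \<in> N" for x
    using that nd(1,3) by (auto simp: N_def numeral_2_eq_2)
  have even_exp: "x [^]\<^bsub>D\<^esub> (2 * j :: nat) = \<one>\<^bsub>D\<^esub>" if "x \<in> N" for x j
    using N2[OF that] that Nsub by (metis D.nat_pow_one D.nat_pow_pow subsetD)
  have kill: "k c = \<one>\<^bsub>D\<^esub>"
    if k: "k \<in> hom C D" "k ` carrier C \<subseteq> N" and c: "c \<in> carrier C" "c [^] (2::nat) = \<one>" for k c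
  proof -
    obtain i :: nat where i: "c = g [^] i" using gen c by blast
    have "order C dvd i * 2" using c gen_closed i by (simp add: nat_pow_pow pow_eq_id order_eq)
    hence "2 dvd i" unfolding n by (auto simp: dvd_def)
    then obtain j where j: "i = 2 * j" by auto
    have "k g \<in> N" using k gen_closed by auto
    thus ?thesis using hom_pow_generator[OF k(1) D.is_group, of i] i j even_exp by simp
  qed
  interpret block_matrices C D N 2
    by unfold_locales (use finite_carrier D N N2 kill in \<open>auto simp: subgroup_def\<close>)
  have ex: "x [^]\<^bsub>D\<^esub> order C = \<one>\<^bsub>D\<^esub>" if x: "x \<in> carrier D" for x
  proof -
    have "D.ord x dvd order D" by (rule D.ord_dvd_group_order[OF x])
    moreover have "order D dvd order C" using D(3) n by simp
    ultimately show ?thesis using x by (meson D.pow_eq_id dvd_trans)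
  qed
  have 1: "card {k \<in> homs C D. k ` carrier C \<subseteq> N} = 2"
  proof -
    have "card {k \<in> homs C D. k ` carrier C \<subseteq> N} = card N"
      by (rule card_homs_into_subgroup[OF D(1) N]) (use ex Nsub in blast)
    thus ?thesis using nd(2) by (simp add: N_def)
  qed
  have 2: "card (homs D C) = 4"
    using card_homs_into_cyclic[OF D(1,2) finite_cyclic_axioms ex] D(3) by (simp add: order_def)
  have 3: "totient (order C) = 2 ^ Suc b" unfolding n using totient_power_Suc[of 2 "Suc b"] by simp
  let ?T = "{\<beta> \<in> auto D. \<beta> ` N \<subseteq> N}"
  \<comment> \<open>The nontrivial automorphism of $D$ preserving $N$: a shear with axis $N$, multiplying by $n$ outside $N$.\<close>
  define \<gamma> where "\<gamma> = (\<lambda>x\<in>carrier D. if x \<in> N then x else x \<otimes>\<^bsub>D\<^esub> n)"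
  have \<gamma>: "\<gamma> \<one>\<^bsub>D\<^esub> = \<one>\<^bsub>D\<^esub>" "\<gamma> n = n" "\<gamma> d = d \<otimes>\<^bsub>D\<^esub> n" "\<gamma> (d \<otimes>\<^bsub>D\<^esub> n) = d"
    using nd(1-6,9) dnn by (auto simp: \<gamma>_def N_def)
  have mult_out: "x \<otimes>\<^bsub>D\<^esub> y \<in> N" if xy: "x \<in> carrier D - N" "y \<in> carrier D - N" for x y
  proof -
    have out: "\<exists>u\<in>N. z = d \<otimes>\<^bsub>D\<^esub> u" if z: "z \<in> carrier D - N" for z
    proof -
      have "z = d \<otimes>\<^bsub>D\<^esub> \<one>\<^bsub>D\<^esub> \<or> z = d \<otimes>\<^bsub>D\<^esub> n"
        using z D.r_one[OF nd(4)] unfolding nd(7) N_def by auto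
      thus ?thesis by (auto simp: N_def)
    qed
    obtain u v where uv: "x = d \<otimes>\<^bsub>D\<^esub> u" "y = d \<otimes>\<^bsub>D\<^esub> v" "u \<in> N" "v \<in> N"
      using out[OF xy(1)] out[OF xy(2)] by blast
    have "x \<otimes>\<^bsub>D\<^esub> y = (d \<otimes>\<^bsub>D\<^esub> d) \<otimes>\<^bsub>D\<^esub> (u \<otimes>\<^bsub>D\<^esub> v)"
      using uv Nsub nd(4) by (simp add: D.m_ac subset_iff)
    thus ?thesis using uv nd(8) subgroup.m_closed[OF N] unfolding N_def[symmetric] by simp
  qed
  have mult_in: "x \<otimes>\<^bsub>D\<^esub> y \<notin> N" if "x \<in> carrier D - N" "y \<in> N" for x y
  proof
    assume "x \<otimes>\<^bsub>D\<^esub> y \<in> N"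
    hence "x \<otimes>\<^bsub>D\<^esub> y \<otimes>\<^bsub>D\<^esub> inv\<^bsub>D\<^esub> y \<in> N"
      using that N by (simp add: subgroup.m_closed subgroup.m_inv_closed)
    moreover have "x \<otimes>\<^bsub>D\<^esub> y \<otimes>\<^bsub>D\<^esub> inv\<^bsub>D\<^esub> y = x" using that Nsub by (auto simp: D.m_assoc)
    ultimately show False using that by simp
  qed
  have \<gamma>_hom: "\<gamma> \<in> hom D D"
  proof (rule homI)
    fix x y assume xy: "x \<in> carrier D" "y \<in> carrier D"
    have [simp]: "x \<otimes>\<^bsub>D\<^esub> n \<otimes>\<^bsub>D\<^esub> (y \<otimes>\<^bsub>D\<^esub> n) = x \<otimes>\<^bsub>D\<^esub> y"
    proof -
      have "x \<otimes>\<^bsub>D\<^esub> n \<otimes>\<^bsub>D\<^esub> (y \<otimes>\<^bsub>D\<^esub> n) = x \<otimes>\<^bsub>D\<^esub> y \<otimes>\<^bsub>D\<^esub> (n \<otimes>\<^bsub>D\<^esub> n)"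
        using xy nd(1) by (simp add: D.m_ac)
      thus ?thesis using xy nd(3) by simp
    qed
    consider "x \<in> N" "y \<in> N" | "x \<in> N" "y \<notin> N" | "x \<notin> N" "y \<in> N" | "x \<notin> N" "y \<notin> N" by blast
    thus "\<gamma> (x \<otimes>\<^bsub>D\<^esub> y) = \<gamma> x \<otimes>\<^bsub>D\<^esub> \<gamma> y"
    proof cases
      case 1
      hence "x \<otimes>\<^bsub>D\<^esub> y \<in> N" using N by (simp add: subgroup.m_closed)
      thus ?thesis using 1 xy by (simp add: \<gamma>_def)
    next
      case 2
      hence "x \<otimes>\<^bsub>D\<^esub> y \<notin> N" using mult_in[of y x] xy by (simp add: D.m_comm)
      thus ?thesis using 2 xy nd(1) by (simp add: \<gamma>_def D.m_assoc)
    next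
      case 3
      hence "x \<otimes>\<^bsub>D\<^esub> y \<notin> N" using mult_in[of x y] xy by simp
      thus ?thesis using 3 xy nd(1) by (simp add: \<gamma>_def D.m_ac)
    next
      case 4
      hence "x \<otimes>\<^bsub>D\<^esub> y \<in> N" using mult_out xy by simp
      thus ?thesis using 4 xy by (simp add: \<gamma>_def)
    qed
  qed (use nd(1) in \<open>auto simp: \<gamma>_def\<close>)
  have \<gamma>T: "\<gamma> \<in> ?T"
  proof -
    have "inj_on \<gamma> (carrier D)" unfolding nd(7) inj_on_def using nd(2,5,6,9) \<gamma> by auto
    hence "\<gamma> \<in> auto D" using \<gamma>_hom D(2) by (intro autoI) (auto simp: \<gamma>_def)
    thus ?thesis using \<gamma> by (simp add: N_def)
  qed
  have idT: "(\<lambda>x\<in>carrier D. x) \<in> ?T" using D.id_in_auto Nsub by auto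
  have "card ?T = card {d, d \<otimes>\<^bsub>D\<^esub> n}"
  proof (rule bij_betw_same_card[of "\<lambda>f. f d"], rule bij_betw_imageI)
    have fN: "f n = n \<and> f \<one>\<^bsub>D\<^esub> = \<one>\<^bsub>D\<^esub> \<and> f (d \<otimes>\<^bsub>D\<^esub> n) = f d \<otimes>\<^bsub>D\<^esub> n \<and> f d \<in> {d, d \<otimes>\<^bsub>D\<^esub> n}" if f: "f \<in> ?T" for f
    proof -
      have fa: "f \<in> auto D" and fN: "f ` N \<subseteq> N" using f by auto
      note f' = autoD[OF fa]
      have f1: "f \<one>\<^bsub>D\<^esub> = \<one>\<^bsub>D\<^esub>" using hom_one[OF f'(1) D.is_group D.is_group] .
      have ne: "f x \<noteq> f y" if "x \<noteq> y" "x \<in> carrier D" "y \<in> carrier D" for x y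
        using f'(2) that by (auto simp: inj_on_def)
      have "f n \<noteq> \<one>\<^bsub>D\<^esub>" using ne[of n "\<one>\<^bsub>D\<^esub>"] f1 nd(1,2) by simp
      hence fn: "f n = n" using fN by (auto simp: N_def)
      have "f d \<noteq> \<one>\<^bsub>D\<^esub>" "f d \<noteq> n" using ne[of d "\<one>\<^bsub>D\<^esub>"] ne[of d n] f1 fn nd(1,4-6) by simp_all
      moreover have "f d \<in> carrier D" using hom_in_carrier[OF f'(1)] nd(4) by simp
      ultimately have "f d \<in> {d, d \<otimes>\<^bsub>D\<^esub> n}" using nd(7) by blast
      thus ?thesis using f1 fn hom_mult[OF f'(1) nd(4) nd(1)] by simp
    qed
    show "inj_on (\<lambda>f. f d) ?T"
    proof (rule inj_onI)
      fix f f' assume ff: "f \<in> ?T" "f' \<in> ?T" "f d = f' d"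
      have ext: "f \<in> extensional (carrier D)" "f' \<in> extensional (carrier D)" using ff autoD by auto
      show "f = f'"
      proof (rule extensionalityI[OF ext])
        fix x assume "x \<in> carrier D"
        thus "f x = f' x" unfolding nd(7) using fN[OF ff(1)] fN[OF ff(2)] ff(3) by auto
      qed
    qed
    show "(\<lambda>f. f d) ` ?T = {d, d \<otimes>\<^bsub>D\<^esub> n}"
    proof (intro equalityI subsetI)
      fix x assume "x \<in> {d, d \<otimes>\<^bsub>D\<^esub> n}"
      then consider "x = (\<lambda>x\<in>carrier D. x) d" | "x = \<gamma> d" using nd(4) \<gamma>(3) by auto
      thus "x \<in> (\<lambda>f. f d) ` ?T" by cases (use idT \<gamma>T in blast)+
    qed (use fN in auto)
  qed
  also have "\<dots> = 2" using nd(9) by (auto simp: card_insert_if)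
  finally have 4: "card ?T = 2" .
  have "2 ^ Suc b * 4 * 2 * 2 dvd card (auto (C \<times>\<times> D))"
    using card_blocks_dvd unfolding 1 2 4 card_auto 3 .
  thus ?thesis by (simp add: n D(3) mult.commute)
qed

end

section \<open>The elementary abelian group of order eight\<close>

text \<open>
  Concrete coordinates turn the verification of individual automorphisms and their orders into a
  calculation with bits, where addition is inequality.
\<close>

definition bool3 :: "(bool \<times> bool \<times> bool) monoid" where
  "bool3 = \<lparr>carrier = UNIV, monoid.mult = (\<lambda>(x, y, z) (x', y', z'). (x \<noteq> x', y \<noteq> y', z \<noteq> z')),
     one = (False, False, False)\<rparr>"

lemma group_bool3: "group bool3"
  by (rule groupI) (auto simp: bool3_def)

lemma three_dvd_card_auto_bool3: "3 dvd card (auto bool3)"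
proof (rule prime_dvd_card_auto[OF group_bool3])
  let ?f = "\<lambda>(x, y, z). (y, z, x) :: bool \<times> bool \<times> bool"
  show "?f \<in> auto bool3"
    by (rule autoI) (auto simp: bool3_def hom_def inj_on_def extensional_def)
  show "(?f ^^ 3) x = x" for x by (cases x) (simp add: numeral_eq_Suc)
  show "\<exists>x \<in> carrier bool3. ?f x \<noteq> x" by (auto simp: bool3_def)
qed (auto simp: bool3_def)

text \<open>
  The automorphism is the companion matrix of $t^3 + t + 1$ over the field with two elements. This
  polynomial is primitive: its roots generate the multiplicative group of the field with eight
  elements, which has order 7.
\<close>

lemma seven_dvd_card_auto_bool3: "7 dvd card (auto bool3)"
proof (rule prime_dvd_card_auto[OF group_bool3])
  let ?f = "\<lambda>(x, y, z). (y, z, x \<noteq> y) :: bool \<times> bool \<times> bool"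
  show "?f \<in> auto bool3"
    by (rule autoI) (auto simp: bool3_def hom_def inj_on_def extensional_def)
  show "(?f ^^ 7) x = x" for x by (cases x) (auto simp: numeral_eq_Suc)
  show "\<exists>x \<in> carrier bool3. ?f x \<noteq> x" by (auto simp: bool3_def)
qed (auto simp: bool3_def)

text \<open>
  Three elements, each outside the subgroup generated by the previous ones, form a basis.
\<close>

lemma elementary_order_eight_iso_bool3:
  assumes "comm_group G" "finite (carrier G)" "order G = 8"
    and "\<And>x. x \<in> carrier G \<Longrightarrow> x \<otimes>\<^bsub>G\<^esub> x = \<one>\<^bsub>G\<^esub>"
  shows "bool3 \<cong> G"
proof -
  interpret G: comm_group G by fact
  have outside: "\<exists>x \<in> carrier G. x \<notin> A" if "finite A" "card A < 8" for A
  proof (rule ccontr)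
    assume "\<not> ?thesis"
    hence "card (carrier G) \<le> card A" using that(1) by (intro card_mono) auto
    thus False using that(2) assms(3) by (simp add: order_def)
  qed
  obtain a where a: "a \<in> carrier G" "a \<noteq> \<one>\<^bsub>G\<^esub>" using outside[of "{\<one>\<^bsub>G\<^esub>}"] by auto
  have "card {\<one>\<^bsub>G\<^esub>, a} < 8" using a by simp
  then obtain b where b: "b \<in> carrier G" "b \<notin> {\<one>\<^bsub>G\<^esub>, a}" using outside[of "{\<one>\<^bsub>G\<^esub>, a}"] by auto
  have "card {\<one>\<^bsub>G\<^esub>, a, b, a \<otimes>\<^bsub>G\<^esub> b} < 8" by (auto simp: card_insert_if)
  then obtain c where c: "c \<in> carrier G" "c \<notin> {\<one>\<^bsub>G\<^esub>, a, b, a \<otimes>\<^bsub>G\<^esub> b}"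
    using outside[of "{\<one>\<^bsub>G\<^esub>, a, b, a \<otimes>\<^bsub>G\<^esub> b}"] by auto
  define p where "p u x = (if x then u else \<one>\<^bsub>G\<^esub>)" for u x
  have p_closed: "p u x \<in> carrier G" if "u \<in> carrier G" for u x using that by (simp add: p_def)
  have p_add: "p u (x \<noteq> y) = p u x \<otimes>\<^bsub>G\<^esub> p u y" if "u \<in> carrier G" for u x y
    using that assms(4) by (auto simp: p_def)
  have eqI: "u = v" if "u \<otimes>\<^bsub>G\<^esub> v = \<one>\<^bsub>G\<^esub>" "u \<in> carrier G" "v \<in> carrier G" for u v
  proof -
    have "u \<otimes>\<^bsub>G\<^esub> v = v \<otimes>\<^bsub>G\<^esub> v" using that assms(4) by simp
    thus ?thesis using that(2,3) by (metis G.right_cancel)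
  qed
  define \<phi> where "\<phi> = (\<lambda>(x, y, z). (p a x \<otimes>\<^bsub>G\<^esub> p b y) \<otimes>\<^bsub>G\<^esub> p c z)"
  have hom: "\<phi> \<in> hom bool3 G"
  proof (rule homI)
    fix u v :: "bool \<times> bool \<times> bool"
    obtain x y z x' y' z' where uv: "u = (x, y, z)" "v = (x', y', z')" by (cases u, cases v)
    have uv': "u \<otimes>\<^bsub>bool3\<^esub> v = (x \<noteq> x', y \<noteq> y', z \<noteq> z')" by (simp add: bool3_def uv)
    have "\<phi> (u \<otimes>\<^bsub>bool3\<^esub> v) = (p a (x \<noteq> x') \<otimes>\<^bsub>G\<^esub> p b (y \<noteq> y')) \<otimes>\<^bsub>G\<^esub> p c (z \<noteq> z')"
      unfolding uv' \<phi>_def by (simp only: prod.case)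
    also have "\<dots> = \<phi> u \<otimes>\<^bsub>G\<^esub> \<phi> v"
      unfolding \<phi>_def uv prod.case p_add[OF a(1)] p_add[OF b(1)] p_add[OF c(1)]
      using p_closed[OF a(1)] p_closed[OF b(1)] p_closed[OF c(1)] by (simp add: G.m_ac)
    finally show "\<phi> (u \<otimes>\<^bsub>bool3\<^esub> v) = \<phi> u \<otimes>\<^bsub>G\<^esub> \<phi> v" .
  qed (use a b c p_closed in \<open>auto simp: \<phi>_def\<close>)
  have inj: "inj_on \<phi> (carrier bool3)"
  proof (rule hom_eq_one_imp_inj[OF group_bool3 G.is_group hom])
    fix u assume u: "\<phi> u = \<one>\<^bsub>G\<^esub>"
    obtain x y z where xyz: "u = (x, y, z)" by (cases u)
    have 1: "p a x \<otimes>\<^bsub>G\<^esub> p b y = p c z"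
      using u p_closed a b c by - (rule eqI, auto simp: \<phi>_def xyz)
    hence z: "\<not> z" using a b c by (auto simp: p_def split: if_splits)
    hence "p a x \<otimes>\<^bsub>G\<^esub> p b y = \<one>\<^bsub>G\<^esub>" using 1 by (simp add: p_def)
    hence "p a x = p b y" using p_closed a(1) b(1) by - (rule eqI, auto)
    thus "u = \<one>\<^bsub>bool3\<^esub>" using z a b by (auto simp: xyz bool3_def p_def split: if_splits)
  qed
  have card8: "card (carrier bool3) = 8"
    by (simp add: bool3_def card_cartesian_product flip: UNIV_Times_UNIV)
  have "\<phi> ` carrier bool3 = carrier G"
  proof (rule card_subset_eq[OF assms(2)])
    show "\<phi> ` carrier bool3 \<subseteq> carrier G" using hom_in_carrier[OF hom] by blast
    show "card (\<phi> ` carrier bool3) = card (carrier G)"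
      using card_image[OF inj] card8 assms(3) by (simp add: order_def)
  qed
  with hom inj show ?thesis by (intro is_isoI isoI) (auto simp: bij_betw_def)
qed

section \<open>The quotient of the orders is not an odd prime\<close>

theorem theorem3:
  fixes p :: nat
  assumes "Factorial_Ring.prime p" and "odd p"
  shows "\<not> (\<exists>G :: ('a, 'b) monoid_scheme.
            comm_group G \<and> finite (carrier G) \<and>
            real (order (AutoGroup G)) / real (order G) = real p)"
proof
  assume "\<exists>G :: ('a, 'b) monoid_scheme.
            comm_group G \<and> finite (carrier G) \<and>
            real (order (AutoGroup G)) / real (order G) = real p"
  then obtain G :: "('a, 'b) monoid_scheme" where G: "comm_group G" "finite (carrier G)"
    and ratio: "real (order (AutoGroup G)) / real (order G) = real p" by blast
  interpret G: comm_group G by fact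
  have "real (card (auto G)) = real (p * order G)"
    using ratio G(2) by (simp add: order_AutoGroup field_simps G.order_gt_0_iff_finite split: if_splits)
  hence aut_G: "card (auto G) = p * order G" by (simp only: of_nat_eq_iff)
  obtain C D :: "('a, 'b) monoid_scheme" and g where
    C: "finite_cyclic C g" and D: "comm_group D" "finite (carrier D)"
    and expo: "\<And>d. d \<in> carrier D \<Longrightarrow> d [^]\<^bsub>D\<^esub> order C = \<one>\<^bsub>D\<^esub>"
    and iso: "C \<times>\<times> D \<cong> G"
    using cyclic_direct_factor[OF G] by metis
  interpret finite_cyclic C g by fact
  interpret D: comm_group D by fact
  have grp: "group (C \<times>\<times> D)" by (rule DirProd_group[OF is_group D.is_group])
  have order_G: "order G = order C * order D"
    using iso iso_same_card order_DirProd by (metis order_def)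
  have aut: "card (auto (C \<times>\<times> D)) = p * (order C * order D)"
    using card_auto_cong[OF iso grp G.is_group] aut_G order_G by simp
  have D_pos: "order D > 0" using D(2) by (simp add: D.order_gt_0_iff_finite)
  have "3 \<le> p" using assms prime_ge_2_nat[OF assms(1)] by (cases "p = 2") auto
  hence not_small: "\<not> card (auto (C \<times>\<times> D)) < 3 * (order C * order D)"
    unfolding aut by simp
  have "(totient (order C) * card (auto D)) * order D dvd (p * order C) * order D"
    using totient_dvd_card_auto_prod[OF D expo] unfolding aut by (simp add: ac_simps)
  hence key: "totient (order C) * card (auto D) dvd p * order C" using D_pos by simp
  \<comment> \<open>Otherwise $|D| \le 2$, and $G$ has fewer than $3\,|G|$ automorphisms.\<close>
  have even_autD: "even (card (auto D))"
  proof (rule ccontr)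
    assume odd: "odd (card (auto D))"
    obtain a where a: "order D = 2 ^ a"
      using order_power_of_two[OF D.is_group D(2), of 1] odd_card_auto_imp_involutive[OF D odd] by auto
    have "2 ^ a dvd 2 * card (auto D)" using two_group_order_dvd[OF D a] a by simp
    have "a \<le> 1"
    proof (rule ccontr)
      assume "\<not> a \<le> 1"
      hence "2 ^ 2 dvd (2 :: nat) ^ a" by (intro le_imp_power_dvd) simp
      hence "2 * 2 dvd 2 * card (auto D)"
        using \<open>2 ^ a dvd 2 * card (auto D)\<close> by (metis dvd_trans power2_eq_square)
      thus False using odd by simp
    qed
    hence "order D \<le> 2" using a power_increasing[of a 1 "2::nat"] by simp
    thus False using card_auto_prod_small[OF D _ expo] not_small by blast
  qed
  have D_large: "order D > 2"
  proof (rule ccontr)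
    assume "\<not> order D > 2"
    hence "card (auto D) = 1" by (intro small_group_card_auto D D.is_group) simp
    thus False using even_autD by simp
  qed
  obtain m where m: "order C = 2 ^ multiplicity 2 (order C) * m" "odd m"
    using multiplicity_decompose'[of "order C" "2::nat"] order_pos by auto
  define n where "n = multiplicity 2 (order C)"
  have nm: "order C = 2 ^ n * m" "odd m" using m unfolding n_def by blast+
  have "even (totient (order C) * card (auto D))" using even_autD by simp
  hence "even (p * order C)" using key by (rule dvd_trans)
  hence n_pos: "n > 0" using nm assms by (cases n) auto
  then obtain n' where n': "n = Suc n'" by (cases n) auto
  have tot: "totient (order C) = 2 ^ n' * totient m"
    using nm n' totient_mult_coprime[of "2 ^ Suc n'" m] totient_power_Suc[of 2 n'] by simp
  have key': "totient m * card (auto D) dvd p * (2 * m)"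
  proof -
    have "2 ^ n' * totient m * card (auto D) dvd p * (2 ^ Suc n' * m)"
      using key unfolding tot unfolding nm n' .
    hence "2 ^ n' * (totient m * card (auto D)) dvd 2 ^ n' * (p * (2 * m))"
      by (simp only: power_Suc ac_simps)
    thus ?thesis by simp
  qed
  \<comment> \<open>For $m > 2$ both factors on the left of \<open>key'\<close> are even, but the right-hand side is twice an odd number.\<close>
  have "m = 1"
  proof (rule ccontr)
    assume "m \<noteq> 1"
    moreover have "m \<noteq> 0" "m \<noteq> 2" using nm(2) by (auto intro: Nat.gr0I)
    ultimately have "even (totient m)" by (intro totient_even) linarith
    hence "2 * 2 dvd totient m * card (auto D)" using even_autD by (rule mult_dvd_mono)
    hence "2 * 2 dvd p * (2 * m)" using key' by (rule dvd_trans)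
    hence "2 * 2 dvd 2 * (p * m)" by (simp only: mult.left_commute)
    thus False using assms nm by simp
  qed
  have C2: "order C = 2 ^ Suc n'" using nm n' \<open>m = 1\<close> by simp
  have autD_dvd: "card (auto D) dvd 2 * p" using key' \<open>m = 1\<close> by (simp add: mult.commute)
  obtain a where a: "order D = 2 ^ a"
    using order_power_of_two[OF D.is_group D(2), of "Suc n'"] expo unfolding C2 by blast
  have "order D dvd 2 * card (auto D)" by (rule two_group_order_dvd[OF D a])
  also have "\<dots> dvd 2 * (2 * p)" using autD_dvd by (intro mult_dvd_mono) auto
  finally have "2 ^ a dvd 4 * p" unfolding a by simp
  hence "2 ^ a dvd (4::nat)"
    using assms(2) coprime_dvd_mult_left_iff[of "2 ^ a" p 4] by simp
  hence "(2::nat) ^ a \<le> 2 ^ 2" by (intro dvd_imp_le) simp_all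
  hence "a \<le> 2" by (rule power_le_imp_le_exp[rotated]) simp
  moreover have "a > 1"
  proof (rule ccontr)
    assume "\<not> a > 1"
    thus False using D_large power_increasing[of a 1 "2::nat"] unfolding a by simp
  qed
  ultimately have D4: "order D = 4" using a by (simp add: eval_nat_numeral le_Suc_eq)
  show False
  proof (cases n')
    case (Suc b)
    hence "2 * (order C * order D) dvd p * (order C * order D)"
      using card_auto_prod_order_four[OF D D4, of b] C2 unfolding aut by simp
    hence "2 dvd p" using order_pos D_pos by simp
    thus False using assms by simp
  next
    case 0
    hence C2: "order C = 2" using C2 by simp
    have "x \<otimes>\<^bsub>C \<times>\<times> D\<^esub> x = \<one>\<^bsub>C \<times>\<times> D\<^esub>" if x: "x \<in> carrier (C \<times>\<times> D)" for x
    proof -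
      obtain c d where cd: "x = (c, d)" "c \<in> carrier C" "d \<in> carrier D" using x by auto
      have "c [^]\<^bsub>C\<^esub> (2::nat) = \<one>\<^bsub>C\<^esub>" "d [^]\<^bsub>D\<^esub> (2::nat) = \<one>\<^bsub>D\<^esub>"
        using pow_order_eq_1[OF cd(2)] expo[OF cd(3)] C2 by simp_all
      thus ?thesis using cd by (simp add: numeral_2_eq_2)
    qed
    moreover have "comm_group (C \<times>\<times> D)"
      by (intro group.group_comm_groupI[OF grp]) (auto simp: comm_groupE(4)[OF comm] D.m_comm)
    ultimately have "bool3 \<cong> C \<times>\<times> D"
      using D4 C2 finite_carrier D(2)
      by (intro elementary_order_eight_iso_bool3) (auto simp: order_DirProd)
    hence "card (auto bool3) = card (auto (C \<times>\<times> D))"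
      by (intro card_auto_cong group_bool3 grp)
    hence card8: "card (auto bool3) = p * 8" using aut C2 D4 by simp
    have "3 dvd p * 8" using three_dvd_card_auto_bool3 card8 by simp
    hence "3 dvd p" by presburger
    have "7 dvd p * 8" using seven_dvd_card_auto_bool3 card8 by simp
    hence "7 dvd p" by presburger
    \<comment> \<open>A prime has no two distinct prime divisors, and 3 and 7 both divide $p$.\<close>
    have "p = 3"
    proof -
      have "\<forall>m. m dvd p \<longrightarrow> m = 1 \<or> m = p"
        using assms(1) unfolding prime_nat_iff by (rule conjunct2)
      from this[rule_format, OF \<open>3 dvd p\<close>] have "(3::nat) = 1 \<or> 3 = p" .
      thus ?thesis by simp
    qed
    thus False using \<open>7 dvd p\<close> by simp
  qed
qed

end
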